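(* Let $(M^{2n},g,J)$ be a Kähler toric manifold with symplectic potential $\Phi=\Phi(x_1,\dots,x_n)$. The Einstein condition, with Einstein constant $\lambda$, is equivalent to the equation $$\log(\det(h))=\sum_{j=1}^{n}(-2\lambda x_j+C_j)\frac{\partial\Phi}{\partial x_j}+2\lambda\Phi+E,$$ where $E$ and the $C_j$ are constants and $h^{-1}$ is the matrix whose $ij$-th entry is $\frac{\partial^2\Phi}{\partial x_i\partial x_j}$.
   Context: A Kähler toric manifold is a Kähler manifold $(M^{2n},J,\omega)$ with a smooth Hamiltonian $T^n$-action preserving the Kähler structure. On the open dense set where the action is free there are symplectic (Darboux) coordinates $(x_1,\dots,x_n,\phi_1,\dots,\phi_n)$, with $x$ the moment map and $\phi$ angular coordinates on $T^n$, in which $\omega=\sum dx_i\wedge d\phi_i$ and $g=\sum h^{ij}dx_idx_j+\sum h_{ij}d\phi_id\phi_j$, where $h=(h_{ij}(x))$ is symmetric positive definite, $(h^{ij})=h^{-1}$, and $h^{ij}=\frac{\partial^2\Phi}{\partial x_i\partial x_j}$; $\Phi$ is called the symplectic potential. The Einstein condition is: Ricci tensor $=\lambda g$. *)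

theory Defs
  imports "HOL-Analysis.Analysis"
begin

section \<open>Smooth functions on open subsets of Euclidean spaces\<close>

abbreviation (input) fderiv :: "('a::real_normed_vector \<Rightarrow> 'b::real_normed_vector) \<Rightarrow> 'a \<Rightarrow> 'a \<Rightarrow> 'b" where
  "fderiv f x \<equiv> frechet_derivative f (at x)"

text \<open>Intended for open \<open>S\<close> only, since derivatives are two-sided.\<close>

primrec Ck_on :: "nat \<Rightarrow> 'a::euclidean_space set \<Rightarrow> ('a \<Rightarrow> 'b::real_normed_vector) \<Rightarrow> bool" where
  "Ck_on 0 S f \<longleftrightarrow> continuous_on S f"
| "Ck_on (Suc k) S f \<longleftrightarrow>
     (\<forall>x\<in>S. f differentiable (at x)) \<and> (\<forall>v. Ck_on k S (\<lambda>x. fderiv f x v))"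

definition smooth_on :: "'a::euclidean_space set \<Rightarrow> ('a \<Rightarrow> 'b::real_normed_vector) \<Rightarrow> bool" where
  "smooth_on S f \<longleftrightarrow> (\<forall>k. Ck_on k S f)"

definition partial :: "'n::finite \<Rightarrow> (real^'n \<Rightarrow> real) \<Rightarrow> real^'n \<Rightarrow> real" where
  "partial i f x = fderiv f x (axis i 1)"

definition hessian :: "(real^'n \<Rightarrow> real) \<Rightarrow> real^'n \<Rightarrow> real^'n^'n" where
  "hessian f x = (\<chi> i j. partial i (partial j f) x)"


section \<open>Ricci tensor of a metric on an open subset of a Euclidean space\<close>

text \<open>
  A field \<open>G\<close> of bilinear forms has value \<open>G x v w\<close> at the point \<open>x\<close> on the tangent vectors
  \<open>v\<close>, \<open>w\<close>. The Levi-Civita connection is \<open>\<nabla>\<^sub>v W = D\<^sub>v W + \<Gamma>(v, W)\<close>, where \<open>\<Gamma>\<close> is determined by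
  the Koszul formula for constant vector fields, \<open>R(u,v) = [\<nabla>\<^sub>u,\<nabla>\<^sub>v]\<close> for constant \<open>u\<close>, \<open>v\<close>, and
  \<open>Ric(v,w)\<close> is the trace of \<open>u \<mapsto> R(u,v)w\<close> (positive on round spheres).
\<close>

definition christoffel ::
    "('a::euclidean_space \<Rightarrow> 'a \<Rightarrow> 'a \<Rightarrow> real) \<Rightarrow> 'a \<Rightarrow> 'a \<Rightarrow> 'a \<Rightarrow> 'a" where
  "christoffel G x v w = (THE u. \<forall>z. G x u z =
     (fderiv (\<lambda>y. G y w z) x v + fderiv (\<lambda>y. G y v z) x w - fderiv (\<lambda>y. G y v w) x z) / 2)"

definition riemann ::
    "('a::euclidean_space \<Rightarrow> 'a \<Rightarrow> 'a \<Rightarrow> real) \<Rightarrow> 'a \<Rightarrow> 'a \<Rightarrow> 'a \<Rightarrow> 'a \<Rightarrow> 'a" where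
  "riemann G x u v w =
     fderiv (\<lambda>y. christoffel G y v w) x u - fderiv (\<lambda>y. christoffel G y u w) x v
     + christoffel G x u (christoffel G x v w) - christoffel G x v (christoffel G x u w)"

definition ricci ::
    "('a::euclidean_space \<Rightarrow> 'a \<Rightarrow> 'a \<Rightarrow> real) \<Rightarrow> 'a \<Rightarrow> 'a \<Rightarrow> 'a \<Rightarrow> real" where
  "ricci G x v w = (\<Sum>b\<in>Basis. riemann G x b v w \<bullet> b)"


section \<open>Complex manifolds\<close>

text \<open>
  A manifold is a whole Hausdorff, second countable type \<open>'m\<close> with an atlas (not necessarily
  maximal) of charts in \<open>\<complex>\<^sup>n\<close>; a chart is its domain together with its coordinate map.
  The complex structure \<open>J\<close> is part of the atlas: in every chart it is multiplication by \<open>\<i>\<close>.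
\<close>

type_synonym ('m, 'n) chart = "'m set \<times> ('m \<Rightarrow> complex^'n)"

abbreviation cdom :: "('m, 'n) chart \<Rightarrow> 'm set" where "cdom \<equiv> fst"
abbreviation cmap :: "('m, 'n) chart \<Rightarrow> 'm \<Rightarrow> complex^'n" where "cmap \<equiv> snd"
abbreviation cimg :: "('m, 'n) chart \<Rightarrow> (complex^'n) set" where "cimg c \<equiv> cmap c ` cdom c"
abbreviation cinv :: "('m, 'n) chart \<Rightarrow> complex^'n \<Rightarrow> 'm" where
  "cinv c \<equiv> inv_into (cdom c) (cmap c)"

abbreviation Jmul :: "complex^'n \<Rightarrow> complex^'n" where "Jmul v \<equiv> \<i> *s v"

definition holomorphic_map_on ::
    "(complex^'n) set \<Rightarrow> (complex^'n \<Rightarrow> complex^'n) \<Rightarrow> bool" where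
  "holomorphic_map_on S f \<longleftrightarrow>
     smooth_on S f \<and> (\<forall>z\<in>S. \<forall>v. fderiv f z (Jmul v) = Jmul (fderiv f z v))"

definition complex_atlas ::
    "('m::{t2_space,second_countable_topology}, 'n::finite) chart set \<Rightarrow> bool" where
  "complex_atlas A \<longleftrightarrow>
     (\<Union>c\<in>A. cdom c) = UNIV \<and>
     (\<forall>c\<in>A. open (cdom c) \<and> open (cimg c) \<and> homeomorphism (cdom c) (cimg c) (cmap c) (cinv c)) \<and>
     (\<forall>c\<in>A. \<forall>d\<in>A. holomorphic_map_on (cmap c ` (cdom c \<inter> cdom d)) (cmap d \<circ> cinv c))"

text \<open>Smooth maps from an open subset of a Euclidean space into the manifold, and out of it.\<close>

definition smooth_into ::
    "('m::topological_space, 'n::finite) chart set \<Rightarrow> 'e::euclidean_space set \<Rightarrow> ('e \<Rightarrow> 'm) \<Rightarrow> bool" where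
  "smooth_into A S f \<longleftrightarrow>
     continuous_on S f \<and> (\<forall>d\<in>A. smooth_on (S \<inter> f -` cdom d) (cmap d \<circ> f))"

definition smooth_fun :: "('m, 'n::finite) chart set \<Rightarrow> ('m \<Rightarrow> 'e::real_normed_vector) \<Rightarrow> bool" where
  "smooth_fun A f \<longleftrightarrow> (\<forall>c\<in>A. smooth_on (cimg c) (f \<circ> cinv c))"


section \<open>Kaehler metrics\<close>

text \<open>
  A covariant 2-tensor assigns to every chart \<open>c\<close> its coordinate representation, a field of
  bilinear forms on \<open>cimg c\<close>. \<open>pullback_form b d f\<close> is the pullback of such a tensor \<open>b\<close>
  along \<open>f\<close> at points mapped into \<open>cdom d\<close>, computed in the chart \<open>d\<close>.
\<close>

type_synonym ('m, 'n) form = "('m, 'n) chart \<Rightarrow> complex^'n \<Rightarrow> complex^'n \<Rightarrow> complex^'n \<Rightarrow> real"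

definition pullback_form ::
    "('m, 'n::finite) form \<Rightarrow> ('m, 'n) chart \<Rightarrow> ('e::euclidean_space \<Rightarrow> 'm) \<Rightarrow> 'e \<Rightarrow> 'e \<Rightarrow> 'e \<Rightarrow> real" where
  "pullback_form b d f x v w =
     b d (cmap d (f x)) (fderiv (cmap d \<circ> f) x v) (fderiv (cmap d \<circ> f) x w)"

definition riemannian_metric :: "('m, 'n::finite) chart set \<Rightarrow> ('m, 'n) form \<Rightarrow> bool" where
  "riemannian_metric A g \<longleftrightarrow>
     (\<forall>c\<in>A.
        (\<forall>v w. smooth_on (cimg c) (\<lambda>z. g c z v w)) \<and>
        (\<forall>z\<in>cimg c. bilinear (g c z) \<and> (\<forall>v w. g c z v w = g c z w v) \<and> (\<forall>v. v \<noteq> 0 \<longrightarrow> g c z v v > 0))) \<and>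
     (\<forall>c\<in>A. \<forall>d\<in>A. \<forall>z\<in>cmap c ` (cdom c \<inter> cdom d). pullback_form g d (cinv c) z = g c z)"

definition kaehler_form :: "('m, 'n::finite) form \<Rightarrow> ('m, 'n) form" where
  "kaehler_form g c z v w = g c z (Jmul v) w"

definition kaehler_metric :: "('m, 'n::finite) chart set \<Rightarrow> ('m, 'n) form \<Rightarrow> bool" where
  "kaehler_metric A g \<longleftrightarrow>
     riemannian_metric A g \<and>
     (\<forall>c\<in>A. \<forall>z\<in>cimg c. \<forall>v w. g c z (Jmul v) (Jmul w) = g c z v w) \<and>
     (\<forall>c\<in>A. \<forall>z\<in>cimg c. \<forall>u v w.
        fderiv (\<lambda>y. kaehler_form g c y v w) z u
        + fderiv (\<lambda>y. kaehler_form g c y w u) z v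
        + fderiv (\<lambda>y. kaehler_form g c y u v) z w = 0)"

definition einstein :: "('m, 'n::finite) chart set \<Rightarrow> ('m, 'n) form \<Rightarrow> real \<Rightarrow> bool" where
  "einstein A g lam \<longleftrightarrow> (\<forall>c\<in>A. \<forall>z\<in>cimg c. \<forall>v w. ricci (g c) z v w = lam * g c z v w)"


section \<open>Kaehler toric manifolds\<close>

text \<open>\<open>T\<^sup>n\<close> is \<open>\<real>\<^sup>n / (2\<pi>\<int>)\<^sup>n\<close>, and its actions are the \<open>\<real>\<^sup>n\<close>-actions that are trivial on the lattice.\<close>

definition period_lattice :: "(real^'n) set" where
  "period_lattice = {t. \<forall>j. \<exists>k::int. t $ j = 2 * pi * of_int k}"

definition torus_action ::
    "('m::topological_space, 'n::finite) chart set \<Rightarrow> (real^'n \<Rightarrow> 'm \<Rightarrow> 'm) \<Rightarrow> bool" where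
  "torus_action A \<alpha> \<longleftrightarrow>
     (\<forall>s t m. \<alpha> (s + t) m = \<alpha> s (\<alpha> t m)) \<and>
     (\<forall>t\<in>period_lattice. \<forall>m. \<alpha> t m = m) \<and>
     (\<forall>c\<in>A. smooth_into A (UNIV \<times> cimg c) (\<lambda>(t, z). \<alpha> t (cinv c z)))"

definition preserves_kaehler ::
    "('m, 'n::finite) chart set \<Rightarrow> ('m, 'n) form \<Rightarrow> (real^'n \<Rightarrow> 'm \<Rightarrow> 'm) \<Rightarrow> bool" where
  "preserves_kaehler A g \<alpha> \<longleftrightarrow>
     (\<forall>t. \<forall>c\<in>A. \<forall>d\<in>A. \<forall>z\<in>cimg c. \<alpha> t (cinv c z) \<in> cdom d \<longrightarrow>
        pullback_form g d (\<alpha> t \<circ> cinv c) z = g c z \<and>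
        (\<forall>v. fderiv (cmap d \<circ> \<alpha> t \<circ> cinv c) z (Jmul v) = Jmul (fderiv (cmap d \<circ> \<alpha> t \<circ> cinv c) z v)))"

definition fundamental_field ::
    "(real^'n::finite \<Rightarrow> 'm \<Rightarrow> 'm) \<Rightarrow> real^'n \<Rightarrow> ('m, 'n) chart \<Rightarrow> complex^'n \<Rightarrow> complex^'n" where
  "fundamental_field \<alpha> \<xi> c z = vector_derivative (\<lambda>s. cmap c (\<alpha> (s *\<^sub>R \<xi>) (cinv c z))) (at 0)"

text \<open>
  Sign convention: \<open>d\<langle>\<mu>,\<xi>\<rangle> = \<omega>(\<cdot>, X\<^sub>\<xi>)\<close>, the one for which the components \<open>x\<^sub>j\<close> of \<open>\<mu>\<close> and the
  angles \<open>\<phi>\<^sub>j\<close> satisfy \<open>\<omega> = \<Sum> dx\<^sub>j \<and> d\<phi>\<^sub>j\<close>.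
\<close>

definition moment_map ::
    "('m, 'n::finite) chart set \<Rightarrow> ('m, 'n) form \<Rightarrow> (real^'n \<Rightarrow> 'm \<Rightarrow> 'm) \<Rightarrow> ('m \<Rightarrow> real^'n) \<Rightarrow> bool" where
  "moment_map A g \<alpha> \<mu> \<longleftrightarrow>
     smooth_fun A \<mu> \<and>
     (\<forall>t m. \<mu> (\<alpha> t m) = \<mu> m) \<and>
     (\<forall>c\<in>A. \<forall>z\<in>cimg c. \<forall>v \<xi>.
        fderiv (\<mu> \<circ> cinv c) z v \<bullet> \<xi> = kaehler_form g c z v (fundamental_field \<alpha> \<xi> c z))"

definition free_locus :: "(real^'n \<Rightarrow> 'm \<Rightarrow> 'm) \<Rightarrow> 'm set" where
  "free_locus \<alpha> = {m. \<forall>t. \<alpha> t m = m \<longrightarrow> t \<in> period_lattice}"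

text \<open>
  The complex dimension of the manifold equals the dimension \<open>CARD('n)\<close> of the torus.
  On a connected manifold the last three clauses are equivalent to effectiveness of the action, by
  the principal orbit theorem.
\<close>

definition kaehler_toric ::
    "('m::{t2_space,second_countable_topology}, 'n::finite) chart set \<Rightarrow> ('m, 'n) form \<Rightarrow>
     (real^'n \<Rightarrow> 'm \<Rightarrow> 'm) \<Rightarrow> ('m \<Rightarrow> real^'n) \<Rightarrow> bool" where
  "kaehler_toric A g \<alpha> \<mu> \<longleftrightarrow>
     connected (UNIV :: 'm set) \<and> complex_atlas A \<and> kaehler_metric A g \<and>
     torus_action A \<alpha> \<and> preserves_kaehler A g \<alpha> \<and> moment_map A g \<alpha> \<mu> \<and>
     open (free_locus \<alpha>) \<and> closure (free_locus \<alpha>) = UNIV \<and> connected (free_locus \<alpha>)"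

definition moment_region :: "(real^'n \<Rightarrow> 'm \<Rightarrow> 'm) \<Rightarrow> ('m \<Rightarrow> real^'n) \<Rightarrow> (real^'n) set" where
  "moment_region \<alpha> \<mu> = \<mu> ` free_locus \<alpha>"

text \<open>
  Symplectic coordinates are given by the inverse parametrization \<open>P(x,\<phi>)\<close> of the free locus,
  with \<open>\<phi>\<close> lifted from \<open>T\<^sup>n\<close> to \<open>\<real>\<^sup>n\<close>. That \<open>x\<close> is the moment map and that \<open>T\<^sup>n\<close> acts by translation
  of \<open>\<phi>\<close> makes \<open>P\<close> injective modulo the lattice. Tangent vectors are written as pairs
  \<open>(a, b)\<close> of their \<open>x\<close>- and \<open>\<phi>\<close>-components.
\<close>

definition symplectic_coordinates ::
    "('m::topological_space, 'n::finite) chart set \<Rightarrow> ('m, 'n) form \<Rightarrow> (real^'n \<Rightarrow> 'm \<Rightarrow> 'm) \<Rightarrow>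
     ('m \<Rightarrow> real^'n) \<Rightarrow> ((real^'n) \<times> (real^'n) \<Rightarrow> 'm) \<Rightarrow> (real^'n \<Rightarrow> real^'n^'n) \<Rightarrow> bool" where
  "symplectic_coordinates A g \<alpha> \<mu> P h \<longleftrightarrow>
     open (moment_region \<alpha> \<mu>) \<and>
     smooth_into A (moment_region \<alpha> \<mu> \<times> UNIV) P \<and>
     P ` (moment_region \<alpha> \<mu> \<times> UNIV) = free_locus \<alpha> \<and>
     (\<forall>x\<in>moment_region \<alpha> \<mu>. \<forall>\<phi>. \<mu> (P (x, \<phi>)) = x \<and> (\<forall>t. P (x, \<phi> + t) = \<alpha> t (P (x, \<phi>)))) \<and>
     (\<forall>x\<in>moment_region \<alpha> \<mu>. transpose (h x) = h x \<and> (\<forall>v. v \<noteq> 0 \<longrightarrow> v \<bullet> (h x *v v) > 0)) \<and>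
     (\<forall>d\<in>A. \<forall>x\<in>moment_region \<alpha> \<mu>. \<forall>\<phi>. P (x, \<phi>) \<in> cdom d \<longrightarrow> (\<forall>a b a' b'.
        pullback_form (kaehler_form g) d P (x, \<phi>) (a, b) (a', b') = a \<bullet> b' - a' \<bullet> b \<and>
        pullback_form g d P (x, \<phi>) (a, b) (a', b') =
          (\<Sum>i\<in>UNIV. \<Sum>j\<in>UNIV. matrix_inv (h x) $ i $ j * a $ i * a' $ j)
          + (\<Sum>i\<in>UNIV. \<Sum>j\<in>UNIV. h x $ i $ j * b $ i * b' $ j)))"

definition symplectic_potential ::
    "(real^'n) set \<Rightarrow> (real^'n \<Rightarrow> real^'n^'n) \<Rightarrow> (real^'n \<Rightarrow> real) \<Rightarrow> bool" where
  "symplectic_potential U h \<Phi> \<longleftrightarrow> smooth_on U \<Phi> \<and> (\<forall>x\<in>U. matrix_inv (h x) = hessian \<Phi> x)"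

end

theory Submission
  imports Defs
begin

text \<open>
  In symplectic coordinates the metric is \<open>S dx\<^sup>2 + h d\<phi>\<^sup>2\<close> with \<open>S = h\<^sup>-\<^sup>1\<close> the Hessian of \<open>\<Phi>\<close>. Write
  \<open>T\<^sub>a\<close> for the derivative of \<open>S\<close> along \<open>a\<close>, so that \<open>T\<^sub>a c = T\<^sub>c a\<close>, and \<open>W = h \<nabla> log det h\<close>. The Koszul
  formula gives the Levi-Civita connection in closed form; since the volume density is constant its
  trace vanishes, and the Ricci tensor comes out as
  \<open>Ric((a,b),(a',b')) = - (a' \<bullet> S DW(a) + b' \<bullet> DW(hb)) / 2\<close>. Hence the metric is Einstein iff
  \<open>DW = -2 \<lambda> id\<close>, that is, \<open>W = -2 \<lambda> x + C\<close> on the connected moment region. As \<open>\<nabla> log det h = S W\<close>, this is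
  the derivative of the asserted equation. The Einstein condition passes between symplectic coordinates
  and complex charts by naturality of the Ricci tensor, and from the free locus to the whole manifold
  by density.
\<close>

section \<open>Smooth functions and symmetry of second derivatives\<close>

text \<open>Two features of the definitions shape the proof. \<open>christoffel\<close> is a
  definite description, not a formula with an inverse matrix, so its regularity in a chart has to
  come from a theory of positive definite linear systems depending on a parameter. And
  \<open>P\<close> is periodic in the angles, so curvature is compared through local isometries and
  not through a global change of coordinates. The Einstein condition collapses to one equation on
  x-directions because the complex structure sends \<open>(0, b)\<close> to
  \<open>(- (h b), 0)\<close>: both the metric and the Ricci tensor have as angular block their
  x-block evaluated at \<open>h b\<close> and \<open>h b'\<close>. In the Ricci computation the
  vanishing trace of the connection kills two of the four curvature terms; what remains of the other
  two is exactly the product rule for the field \<open>W = h \<nabla> log det h\<close>, whose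
  definition contains \<open>h\<close> twice and the derivative of its inverse once.\<close>

lemma fderiv_cong_open:
  assumes "open S" "x \<in> S" "\<And>y. y \<in> S \<Longrightarrow> f y = g y"
  shows "fderiv f x = fderiv g x"
proof -
  \<comment> \<open>\<open>frechet_derivative\<close> is a choice from the predicate
    \<open>has_derivative\<close>, so equivalent predicates give equal values, also at points
    without a derivative.\<close>
  have "(f has_derivative f') (at x) \<longleftrightarrow> (g has_derivative f') (at x)" for f'
    using assms has_derivative_transform_within_open[of f f' x UNIV S g]
      has_derivative_transform_within_open[of g f' x UNIV S f] by auto
  then show ?thesis unfolding frechet_derivative_def by simp
qed

lemma differentiable_cong_open:
  assumes "open S" "x \<in> S" "\<And>y. y \<in> S \<Longrightarrow> f y = g y"
  shows "f differentiable (at x) \<longleftrightarrow> g differentiable (at x)"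
  using assms has_derivative_transform_within_open[of f _ x UNIV S g]
    has_derivative_transform_within_open[of g _ x UNIV S f] unfolding differentiable_def by metis

lemma fderiv_eqI: "(f has_derivative f') (at x) \<Longrightarrow> fderiv f x = f'"
  by (metis frechet_derivative_at)

lemma has_derivative_fderiv: "f differentiable (at x) \<Longrightarrow> (f has_derivative fderiv f x) (at x)"
  by (simp add: frechet_derivative_works)

text \<open>Rules of calculus give the derivative of a compound function on \<open>S\<close> only.
  This lemma lets the inductions below replace \<open>fderiv\<close> by such a formula.\<close>

lemma Ck_on_cong:
  assumes "open S" "\<And>x. x \<in> S \<Longrightarrow> f x = g x"
  shows "Ck_on k S f \<longleftrightarrow> Ck_on k S g"
  using assms(2)
proof (induction k arbitrary: f g)
  case 0
  then show ?case by (auto intro: continuous_on_cong)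
next
  case (Suc k)
  have "Ck_on k S (\<lambda>x. fderiv f x v) \<longleftrightarrow> Ck_on k S (\<lambda>x. fderiv g x v)" for v
    using fderiv_cong_open[OF assms(1) _ Suc.prems] by (intro Suc.IH) simp
  then show ?case
    using differentiable_cong_open[OF assms(1) _ Suc.prems] by simp
qed

lemma Ck_on_imp_continuous_on: "Ck_on k S f \<Longrightarrow> continuous_on S f"
  by (cases k)
    (auto intro!: continuous_at_imp_continuous_on differentiable_imp_continuous_within)

lemma Ck_on_SucD: "Ck_on (Suc k) S f \<Longrightarrow> Ck_on k S f"
proof (induction k arbitrary: f)
  case 0
  then show ?case using Ck_on_imp_continuous_on[of "Suc 0" S f] by simp
next
  case (Suc k)
  then show ?case by simp
qed

lemma Ck_on_const: "Ck_on k S (\<lambda>x. c)"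
  by (induction k arbitrary: c) auto

lemma Ck_on_add:
  assumes "open S" "Ck_on k S f" "Ck_on k S g"
  shows "Ck_on k S (\<lambda>x. f x + g x)"
  using assms(2,3)
proof (induction k arbitrary: f g)
  case 0
  then show ?case by (auto intro: continuous_intros)
next
  case (Suc k)
  have "fderiv (\<lambda>x. f x + g x) x v = fderiv f x v + fderiv g x v" if "x \<in> S" for x v
    using Suc.prems that
    by (auto intro!: fderiv_eqI[THEN fun_cong] derivative_eq_intros has_derivative_fderiv)
  moreover have "Ck_on k S (\<lambda>x. fderiv f x v + fderiv g x v)" for v
    using Suc by simp
  ultimately have "Ck_on k S (\<lambda>x. fderiv (\<lambda>x. f x + g x) x v)" for v
    by (subst Ck_on_cong[OF assms(1)]) auto
  then show ?case using Suc.prems by auto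
qed

lemma Ck_on_sum:
  assumes "open S" "\<And>i. i \<in> I \<Longrightarrow> Ck_on k S (f i)"
  shows "Ck_on k S (\<lambda>x. \<Sum>i\<in>I. f i x)"
  using assms(2)
  by (induction I rule: infinite_finite_induct) (auto intro: Ck_on_add[OF assms(1)] Ck_on_const)

lemma Ck_on_bounded_linear:
  assumes "open S" "bounded_linear L" "Ck_on k S f"
  shows "Ck_on k S (\<lambda>x. L (f x))"
  using assms(3)
proof (induction k arbitrary: f)
  case 0
  then show ?case using assms(2) by (auto intro: bounded_linear.continuous_on)
next
  case (Suc k)
  have D: "((\<lambda>x. L (f x)) has_derivative (\<lambda>v. L (fderiv f x v))) (at x)" if "x \<in> S" for x
    using Suc.prems that by (auto intro!: bounded_linear.has_derivative[OF assms(2)] has_derivative_fderiv)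
  have "Ck_on k S (\<lambda>x. fderiv (\<lambda>x. L (f x)) x v)" for v
    using Suc by (subst Ck_on_cong[OF assms(1)]) (auto simp: fderiv_eqI[OF D])
  then show ?case using D by (auto simp: differentiable_def)
qed

lemma Ck_on_bounded_bilinear:
  assumes "open S" "bounded_bilinear p" "Ck_on k S f" "Ck_on k S g"
  shows "Ck_on k S (\<lambda>x. p (f x) (g x))"
  using assms(3,4)
proof (induction k arbitrary: f g)
  case 0
  then show ?case using assms(2) by (auto intro: bounded_bilinear.continuous_on)
next
  case (Suc k)
  have D: "((\<lambda>x. p (f x) (g x)) has_derivative
      (\<lambda>v. p (f x) (fderiv g x v) + p (fderiv f x v) (g x))) (at x)" if "x \<in> S" for x
    using Suc.prems that by (auto intro!: bounded_bilinear.FDERIV[OF assms(2)] has_derivative_fderiv)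
  \<comment> \<open>Each Leibniz term keeps one undifferentiated factor, whose order is lowered to
    match the induction hypothesis.\<close>
  have "Ck_on k S f" "Ck_on k S g"
    using Suc.prems by (auto intro: Ck_on_SucD)
  then have "Ck_on k S (\<lambda>x. p (f x) (fderiv g x v) + p (fderiv f x v) (g x))" for v
    using Suc by (intro Ck_on_add[OF assms(1)]) auto
  then have "Ck_on k S (\<lambda>x. fderiv (\<lambda>x. p (f x) (g x)) x v)" for v
    by (subst Ck_on_cong[OF assms(1)]) (auto simp: fderiv_eqI[OF D])
  then show ?case using D by (auto simp: differentiable_def)
qed

lemma smooth_on_differentiable: "smooth_on S f \<Longrightarrow> x \<in> S \<Longrightarrow> f differentiable (at x)"
  unfolding smooth_on_def using Ck_on.simps(2) by blast

lemma smooth_on_fderiv: "smooth_on S f \<Longrightarrow> smooth_on S (\<lambda>x. fderiv f x v)"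
  unfolding smooth_on_def using Ck_on.simps(2) by blast

lemma smooth_on_continuous_on: "smooth_on S f \<Longrightarrow> continuous_on S f"
  unfolding smooth_on_def using Ck_on_imp_continuous_on by blast

text \<open>The quotient is symmetric in \<open>u\<close> and \<open>v\<close>, so its limit yields
  the equality of mixed derivatives. For fixed \<open>t\<close> the numerator is the change over a
  segment in direction \<open>u\<close> of the increment of \<open>f\<close> along
  \<open>t v\<close>; the mean value theorem turns it into a difference of first derivatives, which
  are then expanded to first order at \<open>x\<close>.\<close>

lemma second_difference_limit:
  fixes f :: "'a::real_normed_vector \<Rightarrow> real"
  assumes S: "open S" "x \<in> S" and f: "\<And>y. y \<in> S \<Longrightarrow> f differentiable (at y)"
    and D: "(\<lambda>y. fderiv f y u) differentiable (at x)"
  shows "((\<lambda>t. (f (x + t *\<^sub>R u + t *\<^sub>R v) - f (x + t *\<^sub>R u) - f (x + t *\<^sub>R v) + f x) / t\<^sup>2)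
    \<longlongrightarrow> fderiv (\<lambda>y. fderiv f y u) x v) (at_right 0)"
proof (rule tendstoI)
  fix e :: real assume "e > 0"
  define L where "L = fderiv (\<lambda>y. fderiv f y u) x"
  \<comment> \<open>The two expansion points differ from \<open>x\<close> by vectors whose norms add
    up to at most \<open>t * (M - 1)\<close>. The summand 1 makes \<open>M\<close> positive and the
    estimate strict.\<close>
  define M where "M = 2 * norm u + norm v + 1"
  have M: "M > 0" unfolding M_def by (smt (verit) norm_ge_zero)
  define e' where "e' = e / (2 * M)"
  have "e' > 0" using \<open>e > 0\<close> M by (simp add: e'_def)
  have hL: "((\<lambda>y. fderiv f y u) has_derivative L) (at x)"
    unfolding L_def by (rule has_derivative_fderiv[OF D])
  then have linL: "linear L" by (rule has_derivative_linear)
  from hL \<open>e' > 0\<close> obtain d1 where d1: "d1 > 0"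
    "\<And>y. norm (y - x) < d1 \<Longrightarrow> \<bar>fderiv f y u - fderiv f x u - L (y - x)\<bar> \<le> e' * norm (y - x)"
    unfolding has_derivative_at_alt by (metis real_norm_def)
  from S obtain d2 where d2: "d2 > 0" "ball x d2 \<subseteq> S"
    using open_contains_ball by blast
  define d where "d = min d1 d2"
  have "d > 0" using d1 d2 by (simp add: d_def)
  have main: "\<bar>(f (x + t *\<^sub>R u + t *\<^sub>R v) - f (x + t *\<^sub>R u) - f (x + t *\<^sub>R v) + f x) / t\<^sup>2 - L v\<bar> < e"
    if t: "0 < t" "t < d / M" for t
  proof -
    have tM: "t * M < d" using t M by (simp add: field_simps)
    have near1: "norm (s *\<^sub>R u + t *\<^sub>R v) < d" "norm (s *\<^sub>R u + t *\<^sub>R v) \<le> t * (norm u + norm v)"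
      and near2: "norm (s *\<^sub>R u) < d" "norm (s *\<^sub>R u) \<le> t * norm u" if "0 \<le> s" "s \<le> t" for s
    proof -
      have "norm (s *\<^sub>R u) \<le> t * norm u" using that by (simp add: mult_right_mono)
      moreover have "norm (s *\<^sub>R u + t *\<^sub>R v) \<le> norm (s *\<^sub>R u) + t * norm v"
        using norm_triangle_ineq[of "s *\<^sub>R u" "t *\<^sub>R v"] t by simp
      moreover have "t * M = 2 * (t * norm u) + t * norm v + t" by (simp add: M_def algebra_simps)
      moreover have "0 \<le> t * norm u" "0 \<le> t * norm v" using t by simp_all
      ultimately show "norm (s *\<^sub>R u + t *\<^sub>R v) < d" "norm (s *\<^sub>R u + t *\<^sub>R v) \<le> t * (norm u + norm v)"
        "norm (s *\<^sub>R u) < d" "norm (s *\<^sub>R u) \<le> t * norm u"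
        using tM t unfolding distrib_left by linarith+
    qed
    have inS: "x + w \<in> S" if "norm w < d" for w
      using d2 that by (auto simp: d_def subset_iff dist_norm)
    define \<psi> where "\<psi> s = f (x + s *\<^sub>R u + t *\<^sub>R v) - f (x + s *\<^sub>R u)" for s
    define \<psi>' where "\<psi>' s = fderiv f (x + s *\<^sub>R u + t *\<^sub>R v) u - fderiv f (x + s *\<^sub>R u) u" for s
    have chain: "((\<lambda>s. f (c + s *\<^sub>R u)) has_real_derivative fderiv f (c + s *\<^sub>R u) u) (at s)"
      if "c + s *\<^sub>R u \<in> S" for c s
    proof -
      have h: "(f has_derivative fderiv f (c + s *\<^sub>R u)) (at (c + s *\<^sub>R u))"
        using f[OF that] by (rule has_derivative_fderiv)
      have "((\<lambda>s. c + s *\<^sub>R u) has_derivative (\<lambda>r. r *\<^sub>R u)) (at s)"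
        by (auto intro!: derivative_eq_intros)
      from diff_chain_at[OF this h]
      have "((\<lambda>s. f (c + s *\<^sub>R u)) has_derivative (\<lambda>r. fderiv f (c + s *\<^sub>R u) (r *\<^sub>R u))) (at s)"
        by (simp add: o_def)
      moreover have "fderiv f (c + s *\<^sub>R u) (r *\<^sub>R u) = fderiv f (c + s *\<^sub>R u) u * r" for r
        using linear_scale[OF has_derivative_linear[OF h], of r u] by simp
      ultimately show ?thesis by (simp add: has_field_derivative_def)
    qed
    have "(\<psi> has_real_derivative \<psi>' s) (at s)" if "0 \<le> s" "s \<le> t" for s
    proof -
      have "x + t *\<^sub>R v + s *\<^sub>R u \<in> S" "x + s *\<^sub>R u \<in> S"
        using inS[OF near1(1)[OF that]] inS[OF near2(1)[OF that]] by (simp_all add: algebra_simps)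
      from DERIV_diff[OF chain[OF this(1)] chain[OF this(2)]]
      show ?thesis unfolding \<psi>_def \<psi>'_def by (simp add: add.assoc add.commute[of "t *\<^sub>R v"])
    qed
    from MVT2[OF t(1) this] obtain s where s: "0 < s" "s < t" "\<psi> t - \<psi> 0 = t * \<psi>' s" by auto
    have s': "0 \<le> s" "s \<le> t" using s by auto
    define A where "A = fderiv f (x + s *\<^sub>R u + t *\<^sub>R v) u - fderiv f x u - L (s *\<^sub>R u + t *\<^sub>R v)"
    define B where "B = fderiv f (x + s *\<^sub>R u) u - fderiv f x u - L (s *\<^sub>R u)"
    have "\<bar>A\<bar> \<le> e' * norm (s *\<^sub>R u + t *\<^sub>R v)" "\<bar>B\<bar> \<le> e' * norm (s *\<^sub>R u)"
      using d1(2)[of "x + s *\<^sub>R u + t *\<^sub>R v"] d1(2)[of "x + s *\<^sub>R u"] near1[OF s'] near2[OF s']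
      by (auto simp: A_def B_def d_def algebra_simps)
    moreover have "e' * norm (s *\<^sub>R u + t *\<^sub>R v) \<le> e' * (t * (norm u + norm v))"
      "e' * norm (s *\<^sub>R u) \<le> e' * (t * norm u)"
      using near1[OF s'] near2[OF s'] \<open>e' > 0\<close> by (auto intro: mult_left_mono)
    ultimately have "\<bar>A - B\<bar> \<le> e' * (t * (norm u + norm v)) + e' * (t * norm u)" by linarith
    also have "\<dots> = e' * t * (M - 1)" by (simp add: M_def algebra_simps)
    also have "\<dots> < e' * t * M" using \<open>e' > 0\<close> t by simp
    also have "\<dots> = e * t / 2" using M by (simp add: e'_def)
    finally have AB: "\<bar>A - B\<bar> < e * t / 2" .
    \<comment> \<open>The contributions of \<open>fderiv f x u\<close> and of
      \<open>L (s *\<^sub>R u)\<close> cancel, so the unknown intermediate point \<open>s\<close>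
      survives only in the errors.\<close>
    have "\<psi>' s = t * L v + (A - B)"
      using linear_add[OF linL, of "s *\<^sub>R u" "t *\<^sub>R v"] linear_scale[OF linL, of t v]
      by (simp add: \<psi>'_def A_def B_def)
    then have "(\<psi> t - \<psi> 0) / t\<^sup>2 - L v = (A - B) / t"
      using t s(3) by (simp add: power2_eq_square field_simps)
    moreover have "\<bar>(A - B) / t\<bar> < e" using AB t mult_pos_pos[OF \<open>e > 0\<close> t(1)]
      by (simp add: abs_divide field_simps)
    moreover have "\<psi> t - \<psi> 0 = f (x + t *\<^sub>R u + t *\<^sub>R v) - f (x + t *\<^sub>R u) - f (x + t *\<^sub>R v) + f x"
      by (simp add: \<psi>_def)
    ultimately show ?thesis by simp
  qed
  show "\<forall>\<^sub>F t in at_right 0. dist ((f (x + t *\<^sub>R u + t *\<^sub>R v) - f (x + t *\<^sub>R u) - f (x + t *\<^sub>R v) + f x) / t\<^sup>2)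
      (fderiv (\<lambda>y. fderiv f y u) x v) < e"
    unfolding eventually_at_right_field
    using main \<open>d > 0\<close> M by (intro exI[of _ "d / M"]) (auto simp: dist_real_def L_def)
qed

lemma fderiv_fderiv_commute_real:
  fixes f :: "'a::real_normed_vector \<Rightarrow> real"
  assumes "open S" "x \<in> S" "\<And>y. y \<in> S \<Longrightarrow> f differentiable (at y)"
    and "(\<lambda>y. fderiv f y u) differentiable (at x)" "(\<lambda>y. fderiv f y v) differentiable (at x)"
  shows "fderiv (\<lambda>y. fderiv f y u) x v = fderiv (\<lambda>y. fderiv f y v) x u"
proof (rule tendsto_unique[OF _ second_difference_limit[OF assms(1,2,3,4)]])
  show "((\<lambda>t. (f (x + t *\<^sub>R u + t *\<^sub>R v) - f (x + t *\<^sub>R u) - f (x + t *\<^sub>R v) + f x) / t\<^sup>2)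
    \<longlongrightarrow> fderiv (\<lambda>y. fderiv f y v) x u) (at_right 0)"
    using second_difference_limit[OF assms(1,2,3,5), of u]
    by (simp add: algebra_simps)
qed simp

text \<open>The mean value theorem is real-valued, so the vector-valued case goes through
  components.\<close>

lemma fderiv_fderiv_commute:
  fixes f :: "'a::real_normed_vector \<Rightarrow> 'b::euclidean_space"
  assumes S: "open S" "x \<in> S" and f: "\<And>y. y \<in> S \<Longrightarrow> f differentiable (at y)"
    and u: "(\<lambda>y. fderiv f y u) differentiable (at x)" and v: "(\<lambda>y. fderiv f y v) differentiable (at x)"
  shows "fderiv (\<lambda>y. fderiv f y u) x v = fderiv (\<lambda>y. fderiv f y v) x u"
proof (rule euclidean_eqI)
  fix b :: 'b assume "b \<in> Basis"
  have inner: "((\<lambda>y. F y \<bullet> b) has_derivative (\<lambda>w. fderiv F y w \<bullet> b)) (at y)"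
    if "F differentiable (at y)" for F :: "'a \<Rightarrow> 'b" and y
    by (auto intro!: derivative_eq_intros has_derivative_fderiv that)
  have d1: "fderiv (\<lambda>y. f y \<bullet> b) y = (\<lambda>w. fderiv f y w \<bullet> b)" if "y \<in> S" for y
    by (rule fderiv_eqI[OF inner[OF f[OF that]]])
  have d2: "(\<lambda>y. fderiv (\<lambda>y. f y \<bullet> b) y w) differentiable (at x)"
    "fderiv (\<lambda>y. fderiv (\<lambda>y. f y \<bullet> b) y w) x = (\<lambda>z. fderiv (\<lambda>y. fderiv f y w) x z \<bullet> b)"
    if "(\<lambda>y. fderiv f y w) differentiable (at x)" for w
  proof -
    have "((\<lambda>y. fderiv (\<lambda>y. f y \<bullet> b) y w) has_derivative
        (\<lambda>z. fderiv (\<lambda>y. fderiv f y w) x z \<bullet> b)) (at x)"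
      by (rule has_derivative_transform_within_open[OF inner[OF that] S]) (simp add: d1)
    then show "(\<lambda>y. fderiv (\<lambda>y. f y \<bullet> b) y w) differentiable (at x)"
      "fderiv (\<lambda>y. fderiv (\<lambda>y. f y \<bullet> b) y w) x = (\<lambda>z. fderiv (\<lambda>y. fderiv f y w) x z \<bullet> b)"
      by (auto simp: fderiv_eqI differentiable_def)
  qed
  have "(\<lambda>y. f y \<bullet> b) differentiable (at y)" if "y \<in> S" for y
    using inner[OF f[OF that]] by (auto simp: differentiable_def)
  from fderiv_fderiv_commute_real[OF S this d2(1)[OF u] d2(1)[OF v]]
  show "fderiv (\<lambda>y. fderiv f y u) x v \<bullet> b = fderiv (\<lambda>y. fderiv f y v) x u \<bullet> b"
    by (simp add: d2(2)[OF u] d2(2)[OF v])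
qed

section \<open>Positive definite linear systems with parameters\<close>

lemma bilinear_expand:
  fixes B :: "'a::euclidean_space \<Rightarrow> 'b::euclidean_space \<Rightarrow> 'c::real_normed_vector"
  assumes "bilinear B"
  shows "B p q = (\<Sum>b\<in>Basis. \<Sum>c\<in>Basis. (p \<bullet> b) *\<^sub>R (q \<bullet> c) *\<^sub>R B b c)"
proof -
  have "B p q = B (\<Sum>b\<in>Basis. (p \<bullet> b) *\<^sub>R b) (\<Sum>c\<in>Basis. (q \<bullet> c) *\<^sub>R c)"
    by (simp add: euclidean_representation)
  also have "\<dots> = (\<Sum>(b,c)\<in>Basis \<times> Basis. B ((p \<bullet> b) *\<^sub>R b) ((q \<bullet> c) *\<^sub>R c))"
    by (rule bilinear_sum[OF assms])
  also have "\<dots> = (\<Sum>b\<in>Basis. \<Sum>c\<in>Basis. (p \<bullet> b) *\<^sub>R (q \<bullet> c) *\<^sub>R B b c)"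
    by (simp add: sum.cartesian_product bilinear_lmul[OF assms] bilinear_rmul[OF assms] mult.commute)
  finally show ?thesis .
qed

lemma fderiv_bilinear_family_expand:
  fixes B :: "'z::real_normed_vector \<Rightarrow> 'a::euclidean_space \<Rightarrow> 'b::euclidean_space \<Rightarrow> 'c::real_normed_vector"
  assumes V: "open V" "z \<in> V" and bil: "\<And>y. y \<in> V \<Longrightarrow> bilinear (B y)"
    and diff: "\<And>v w. (\<lambda>y. B y v w) differentiable (at z)"
  shows "fderiv (\<lambda>y. B y p q) z u =
    (\<Sum>b\<in>Basis. \<Sum>c\<in>Basis. (p \<bullet> b) *\<^sub>R (q \<bullet> c) *\<^sub>R fderiv (\<lambda>y. B y b c) z u)"
proof -
  have "fderiv (\<lambda>y. B y p q) z =
      fderiv (\<lambda>y. \<Sum>b\<in>Basis. \<Sum>c\<in>Basis. (p \<bullet> b) *\<^sub>R (q \<bullet> c) *\<^sub>R B y b c) z"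
    by (rule fderiv_cong_open[OF V]) (rule bilinear_expand[OF bil])
  also have "\<dots> = (\<lambda>u. \<Sum>b\<in>Basis. \<Sum>c\<in>Basis. (p \<bullet> b) *\<^sub>R (q \<bullet> c) *\<^sub>R fderiv (\<lambda>y. B y b c) z u)"
    by (rule fderiv_eqI)
      (intro has_derivative_sum has_derivative_scaleR_right has_derivative_fderiv diff)
  finally show ?thesis by simp
qed

lemma bilinear_fderiv_family:
  fixes B :: "'z::real_normed_vector \<Rightarrow> 'a::euclidean_space \<Rightarrow> 'b::euclidean_space \<Rightarrow> 'c::real_normed_vector"
  assumes V: "open V" "z \<in> V" and bil: "\<And>y. y \<in> V \<Longrightarrow> bilinear (B y)"
    and diff: "\<And>v w. (\<lambda>y. B y v w) differentiable (at z)"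
  shows "bilinear (\<lambda>v w. fderiv (\<lambda>y. B y v w) z u)"
proof -
  note E = fderiv_bilinear_family_expand[OF V bil diff, of _ _ u]
  let ?D = "\<lambda>v w. \<Sum>b\<in>Basis. \<Sum>c\<in>Basis. (v \<bullet> b) *\<^sub>R (w \<bullet> c) *\<^sub>R fderiv (\<lambda>y. B y b c) z u"
  have "linear (?D v)" for v
    by (rule linearI)
      (simp_all add: sum.distrib inner_add_left scaleR_add_left scaleR_add_right scaleR_sum_right algebra_simps)
  moreover have "linear (\<lambda>v. ?D v w)" for w
    by (rule linearI)
      (simp_all add: sum.distrib inner_add_left scaleR_add_left scaleR_sum_right algebra_simps)
  ultimately have "bilinear ?D" unfolding bilinear_def by blast
  also have "?D = (\<lambda>v w. fderiv (\<lambda>y. B y v w) z u)"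
    by (intro ext) (rule E[symmetric])
  finally show ?thesis .
qed

text \<open>Leibniz rule for a form whose base point and both arguments move. Only the values at
  fixed arguments are known to be differentiable, so \<open>B\<close> is expanded over bases into
  finitely many scalar coefficients. It serves to differentiate pulled back metrics and
  connections.\<close>

lemma has_derivative_bilinear_family:
  fixes B :: "'z::real_normed_vector \<Rightarrow> 'a::euclidean_space \<Rightarrow> 'b::euclidean_space \<Rightarrow> 'c::real_normed_vector"
    and f :: "'y::real_normed_vector \<Rightarrow> 'z"
  assumes V: "open V" "f x \<in> V" and bil: "\<And>z. z \<in> V \<Longrightarrow> bilinear (B z)"
    and diff: "\<And>v w. (\<lambda>z. B z v w) differentiable (at (f x))"
    and f: "(f has_derivative f') (at x)"
    and p: "(p has_derivative p') (at x)" and q: "(q has_derivative q') (at x)"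
  shows "((\<lambda>y. B (f y) (p y) (q y)) has_derivative
    (\<lambda>u. fderiv (\<lambda>z. B z (p x) (q x)) (f x) (f' u) + B (f x) (p' u) (q x) + B (f x) (p x) (q' u))) (at x)"
proof -
  let ?R = "\<lambda>y. \<Sum>b\<in>Basis. \<Sum>c\<in>Basis. (p y \<bullet> b) *\<^sub>R (q y \<bullet> c) *\<^sub>R B (f y) b c"
  have Bf: "((\<lambda>y. B (f y) b c) has_derivative (\<lambda>u. fderiv (\<lambda>z. B z b c) (f x) (f' u))) (at x)" for b c
    using diff_chain_at[OF f has_derivative_fderiv[OF diff]] by (simp add: o_def)
  have "(?R has_derivative
     (\<lambda>u. \<Sum>b\<in>Basis. \<Sum>c\<in>Basis. (p x \<bullet> b) *\<^sub>R ((q x \<bullet> c) *\<^sub>R fderiv (\<lambda>z. B z b c) (f x) (f' u)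
        + (q' u \<bullet> c) *\<^sub>R B (f x) b c) + (p' u \<bullet> b) *\<^sub>R (q x \<bullet> c) *\<^sub>R B (f x) b c)) (at x)"
    by (intro has_derivative_sum has_derivative_scaleR has_derivative_inner_left p q Bf)
  also have "(\<lambda>u. \<Sum>b\<in>Basis. \<Sum>c\<in>Basis. (p x \<bullet> b) *\<^sub>R ((q x \<bullet> c) *\<^sub>R fderiv (\<lambda>z. B z b c) (f x) (f' u)
        + (q' u \<bullet> c) *\<^sub>R B (f x) b c) + (p' u \<bullet> b) *\<^sub>R (q x \<bullet> c) *\<^sub>R B (f x) b c)
    = (\<lambda>u. fderiv (\<lambda>z. B z (p x) (q x)) (f x) (f' u) + B (f x) (p' u) (q x) + B (f x) (p x) (q' u))"
  proof (rule ext)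
    fix u
    have 1: "fderiv (\<lambda>z. B z (p x) (q x)) (f x) (f' u) =
        (\<Sum>b\<in>Basis. \<Sum>c\<in>Basis. (p x \<bullet> b) *\<^sub>R (q x \<bullet> c) *\<^sub>R fderiv (\<lambda>y. B y b c) (f x) (f' u))"
      by (rule fderiv_bilinear_family_expand[OF V bil diff])
    show "(\<Sum>b\<in>Basis. \<Sum>c\<in>Basis. (p x \<bullet> b) *\<^sub>R ((q x \<bullet> c) *\<^sub>R fderiv (\<lambda>z. B z b c) (f x) (f' u)
        + (q' u \<bullet> c) *\<^sub>R B (f x) b c) + (p' u \<bullet> b) *\<^sub>R (q x \<bullet> c) *\<^sub>R B (f x) b c)
      = fderiv (\<lambda>z. B z (p x) (q x)) (f x) (f' u) + B (f x) (p' u) (q x) + B (f x) (p x) (q' u)"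
      unfolding 1 bilinear_expand[OF bil[OF V(2)], of "p' u" "q x"]
        bilinear_expand[OF bil[OF V(2)], of "p x" "q' u"]
      by (simp add: sum.distrib scaleR_add_right add_ac)
  qed
  finally have R: "(?R has_derivative
     (\<lambda>u. fderiv (\<lambda>z. B z (p x) (q x)) (f x) (f' u) + B (f x) (p' u) (q x) + B (f x) (p x) (q' u))) (at x)" .
  \<comment> \<open>The expansion \<open>?R\<close> is valid only where \<open>f y\<close> lies in
    \<open>V\<close>; continuity of \<open>f\<close> gives this near \<open>x\<close>.\<close>
  have "\<forall>\<^sub>F y in at x. f y \<in> V"
    using has_derivative_continuous[OF f] V by (simp add: continuous_at topological_tendstoD)
  then have "\<forall>\<^sub>F y in at x. ?R y = B (f y) (p y) (q y)"
    by (rule eventually_mono) (rule bilinear_expand[OF bil, symmetric])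
  then show ?thesis
    by (rule has_derivative_transform_eventually[OF R])
      (rule bilinear_expand[OF bil[OF V(2)], symmetric], rule UNIV_I)
qed

section \<open>Positive definite bilinear forms\<close>

lemma linear_functional_expand:
  fixes l :: "'a::euclidean_space \<Rightarrow> real"
  assumes "linear l"
  shows "l z = (\<Sum>b\<in>Basis. (z \<bullet> b) * l b)"
proof -
  have "l z = l (\<Sum>b\<in>Basis. (z \<bullet> b) *\<^sub>R b)" by (simp add: euclidean_representation)
  also have "\<dots> = (\<Sum>b\<in>Basis. (z \<bullet> b) * l b)"
    by (simp add: linear_sum[OF assms] linear_scale[OF assms])
  finally show ?thesis .
qed

lemma linear_inner_eq:
  fixes l :: "'a::euclidean_space \<Rightarrow> real"
  assumes "linear l"
  shows "l z = (\<Sum>b\<in>Basis. l b *\<^sub>R b) \<bullet> z"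
  by (subst linear_functional_expand[OF assms]) (simp add: inner_sum_left inner_commute[of z] mult.commute)

lemma posdef_form_unique:
  assumes "bilinear B" "\<And>v. v \<noteq> 0 \<Longrightarrow> B v v > (0::real)" "\<And>z. B u z = B u' z"
  shows "u = u'"
proof -
  have "B (u - u') (u - u') = 0"
    using assms(3) by (simp add: bilinear_lsub[OF assms(1)])
  then show ?thesis using assms(2)[of "u - u'"] by auto
qed

text \<open>Lax-Milgram in finite dimension: definiteness makes the representing endomorphism
  injective, hence surjective.\<close>

lemma posdef_form_solve:
  fixes B :: "'a::euclidean_space \<Rightarrow> 'a \<Rightarrow> real"
  assumes "bilinear B" "\<And>v. v \<noteq> 0 \<Longrightarrow> B v v > 0" "linear l"
  shows "\<exists>u. \<forall>z. B u z = l z"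
proof -
  define L where "L u = (\<Sum>b\<in>Basis. B u b *\<^sub>R b)" for u
  have L: "B u z = L u \<bullet> z" for u z
    unfolding L_def using assms(1) by (intro linear_inner_eq) (simp add: bilinear_def)
  have "linear L"
    unfolding L_def
    by (rule linearI) (simp_all add: bilinear_ladd[OF assms(1)] bilinear_lmul[OF assms(1)]
        scaleR_add_left sum.distrib scaleR_sum_right)
  moreover have "inj L"
    using posdef_form_unique[OF assms(1,2)] L by (metis injI)
  ultimately have "surj L" by (rule linear_injective_imp_surjective) simp
  then obtain u where "L u = (\<Sum>b\<in>Basis. l b *\<^sub>R b)" by (metis surjD)
  then show ?thesis using L linear_inner_eq[OF assms(3)] by metis
qed

text \<open>Compactness of the unit sphere. A quantitative lower bound, unlike mere positivity,
  survives a small change of the coefficients.\<close>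

lemma posdef_form_bounded_below:
  fixes B :: "'a::euclidean_space \<Rightarrow> 'a \<Rightarrow> real"
  assumes "bilinear B" "\<And>v. v \<noteq> 0 \<Longrightarrow> B v v > 0"
  obtains m where "m > 0" "\<And>v. m * (norm v)\<^sup>2 \<le> B v v"
proof -
  have "compact (sphere (0::'a) 1)" by simp
  moreover have "sphere (0::'a) 1 \<noteq> {}" by simp
  moreover have "continuous_on (sphere 0 1) (\<lambda>v. B v v)"
    by (rule bilinear_continuous_on_compose[OF continuous_on_id continuous_on_id assms(1)])
  ultimately obtain v0 where v0: "v0 \<in> sphere 0 1" "\<And>v. v \<in> sphere 0 1 \<Longrightarrow> B v0 v0 \<le> B v v"
    using continuous_attains_inf[of "sphere 0 1" "\<lambda>v. B v v"] by blast
  have "B v0 v0 > 0" using v0(1) by (intro assms(2)) auto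
  moreover have "B v0 v0 * (norm v)\<^sup>2 \<le> B v v" for v
  proof (cases "v = 0")
    case True then show ?thesis using bilinear_lzero[OF assms(1)] by simp
  next
    case False
    define w where "w = (1 / norm v) *\<^sub>R v"
    have "v = norm v *\<^sub>R w" using False by (simp add: w_def)
    then have "B v v = (norm v)\<^sup>2 * B w w"
      using bilinear_lmul[OF assms(1), of "norm v" w "norm v *\<^sub>R w"] bilinear_rmul[OF assms(1), of w "norm v" w]
      by (simp add: power2_eq_square)
    moreover have "B v0 v0 \<le> B w w" using False by (intro v0(2)) (simp add: w_def)
    ultimately show ?thesis by (simp add: mult.commute mult_right_mono)
  qed
  ultimately show ?thesis using that by blast
qed

text \<open>Since \<open>f\<close> vanishes at \<open>a\<close>, its difference quotient absorbs the
  whole product and continuity of \<open>g\<close> is enough. Below, \<open>g\<close> is a component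
  of a solution whose differentiability is still to be shown.\<close>

lemma has_derivative_mult_vanishing:
  fixes f g :: "'a::real_normed_vector \<Rightarrow> real"
  assumes g: "continuous (at a) g" and f: "(f has_derivative f') (at a)" and "f a = 0"
  shows "((\<lambda>x. g x * f x) has_derivative (\<lambda>y. g a * f' y)) (at a)"
proof -
  have bl: "bounded_linear f'" using f by (rule has_derivative_bounded_linear)
  obtain C where C: "\<And>y. norm (f' y) \<le> norm y * C"
    using bounded_linear.bounded[OF bl] by blast
  have l1: "((\<lambda>y. (f y - f a - f' (y - a)) /\<^sub>R norm (y - a)) \<longlongrightarrow> 0) (at a)"
    using f by (simp add: has_derivative_at_within)
  have gl: "(g \<longlongrightarrow> g a) (at a)" using g by (simp add: continuous_at)
  have "((\<lambda>y. (g y - g a) * (f' (y - a) /\<^sub>R norm (y - a))) \<longlongrightarrow> 0) (at a)"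
  proof (rule Lim_null_comparison)
    have "\<bar>f' (y - a) /\<^sub>R norm (y - a)\<bar> \<le> \<bar>C\<bar>" for y
    proof (cases "y = a")
      case False
      have "\<bar>f' (y - a)\<bar> \<le> norm (y - a) * \<bar>C\<bar>"
        using C[of "y - a"] by (smt (verit) mult_left_mono norm_ge_zero real_norm_def)
      then show ?thesis using False by (simp add: abs_mult field_simps)
    qed simp
    then show "\<forall>\<^sub>F y in at a. norm ((g y - g a) * (f' (y - a) /\<^sub>R norm (y - a))) \<le> \<bar>g y - g a\<bar> * \<bar>C\<bar>"
      by (auto simp: abs_mult intro!: always_eventually mult_left_mono)
    show "((\<lambda>y. \<bar>g y - g a\<bar> * \<bar>C\<bar>) \<longlongrightarrow> 0) (at a)"
      by (rule tendsto_eq_intros gl | simp)+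
  qed
  from tendsto_add[OF tendsto_mult[OF gl l1] this]
  have "((\<lambda>y. (g y * f y - g a * f a - g a * f' (y - a)) /\<^sub>R norm (y - a)) \<longlongrightarrow> 0) (at a)"
    by (simp add: \<open>f a = 0\<close> algebra_simps)
  then show ?thesis
    using bounded_linear_const_mult[OF bl] by (simp add: has_derivative_at_within)
qed

section \<open>Regularity in the parameter of solutions of positive definite linear systems\<close>

context
  fixes S :: "'a::euclidean_space set" and B :: "'a \<Rightarrow> 'b::euclidean_space \<Rightarrow> 'b \<Rightarrow> real"
  assumes S: "open S" and bil: "\<And>x. x \<in> S \<Longrightarrow> bilinear (B x)"
    and pos: "\<And>x v. x \<in> S \<Longrightarrow> v \<noteq> 0 \<Longrightarrow> B x v v > 0"
begin

text \<open>For \<open>d = u x - u a\<close>, subtracting the two systems gives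
  \<open>B x d d = (K x d - K a d) - (B x (u a) d - B a (u a) d)\<close>, which is at most
  \<open>norm d * F x\<close> with \<open>F\<close> tending to 0. Once the coefficients have moved
  by less than \<open>m / 2\<close>, the left side is at least
  \<open>m / 2 * (norm d)\<^sup>2\<close>.\<close>

lemma continuous_on_posdef_solution:
  assumes cB: "\<And>v w. continuous_on S (\<lambda>x. B x v w)" and cK: "\<And>z. continuous_on S (\<lambda>x. K x z)"
    and u: "\<And>x z. x \<in> S \<Longrightarrow> B x (u x) z = K x z"
  shows "continuous_on S u"
proof -
  have "(u \<longlongrightarrow> u a) (at a)" if a: "a \<in> S" for a
  proof -
    obtain m where m: "m > 0" "\<And>v. m * (norm v)\<^sup>2 \<le> B a v v"
      using posdef_form_bounded_below[OF bil[OF a] pos[OF a]] by blast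
    define E where "E x = (\<Sum>b\<in>Basis. \<Sum>c\<in>Basis. \<bar>B x b c - B a b c\<bar>)" for x
    define F where "F x = (\<Sum>b\<in>Basis. \<bar>(K x b - K a b) - (B x (u a) b - B a (u a) b)\<bar>)" for x
    have lim: "((\<lambda>x. B x v w) \<longlongrightarrow> B a v w) (at a)" "((\<lambda>x. K x z) \<longlongrightarrow> K a z) (at a)" for v w z
      using cB cK a S continuous_on_eq_continuous_at continuous_at by metis+
    have E0: "(E \<longlongrightarrow> 0) (at a)" and F0: "(F \<longlongrightarrow> 0) (at a)"
      unfolding E_def F_def by (rule tendsto_eq_intros lim refl | simp)+
    have bd: "norm (u x - u a) \<le> 2 / m * F x" if x: "x \<in> S" "E x < m / 2" for x
    proof -
      define d where "d = u x - u a"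
      have lin: "linear (\<lambda>z. (K x z - K a z) - (B x (u a) z - B a (u a) z))"
      proof -
        have "linear (\<lambda>z. B x (u x) z - B a (u a) z - (B x (u a) z - B a (u a) z))"
          using bil[OF a] bil[OF x(1)] by (intro linear_compose_sub) (auto simp: bilinear_def)
        then show ?thesis by (simp add: u x a)
      qed
      have "B x d d = (K x d - K a d) - (B x (u a) d - B a (u a) d)"
        unfolding d_def using u[OF x(1)] u[OF a] by (simp add: bilinear_lsub[OF bil[OF x(1)]])
      also have "\<dots> = (\<Sum>b\<in>Basis. (d \<bullet> b) * ((K x b - K a b) - (B x (u a) b - B a (u a) b)))"
        by (rule linear_functional_expand[OF lin])
      also have "\<dots> \<le> (\<Sum>b\<in>Basis. norm d * \<bar>(K x b - K a b) - (B x (u a) b - B a (u a) b)\<bar>)"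
      proof (rule sum_mono)
        fix b :: 'b assume "b \<in> Basis"
        then have "\<bar>d \<bullet> b\<bar> \<le> norm d" by (rule Basis_le_norm)
        then have "\<bar>d \<bullet> b\<bar> * \<bar>w\<bar> \<le> norm d * \<bar>w\<bar>" for w by (rule mult_right_mono) simp
        moreover have "(d \<bullet> b) * w \<le> \<bar>d \<bullet> b\<bar> * \<bar>w\<bar>" for w
          using abs_ge_self[of "(d \<bullet> b) * w"] by (simp add: abs_mult)
        ultimately show "(d \<bullet> b) * ((K x b - K a b) - (B x (u a) b - B a (u a) b))
            \<le> norm d * \<bar>(K x b - K a b) - (B x (u a) b - B a (u a) b)\<bar>"
          using order_trans by blast
      qed
      also have "\<dots> = norm d * F x" by (simp add: F_def sum_distrib_left)
      finally have 1: "B x d d \<le> norm d * F x" .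
      have "bilinear (\<lambda>v w. B a v w - B x v w)"
        using bil[OF a] bil[OF x(1)] unfolding bilinear_def by (auto intro: linear_compose_sub)
      then have "B a d d - B x d d = (\<Sum>b\<in>Basis. \<Sum>c\<in>Basis. (d \<bullet> b) *\<^sub>R (d \<bullet> c) *\<^sub>R (B a b c - B x b c))"
        by (rule bilinear_expand)
      also have "\<dots> \<le> (\<Sum>b\<in>Basis. \<Sum>c\<in>Basis. (norm d)\<^sup>2 * \<bar>B x b c - B a b c\<bar>)"
      proof (intro sum_mono)
        fix b c :: 'b assume "b \<in> Basis" "c \<in> Basis"
        then have "\<bar>d \<bullet> b\<bar> * \<bar>d \<bullet> c\<bar> \<le> norm d * norm d" by (intro mult_mono Basis_le_norm) auto
        then have "\<bar>d \<bullet> b\<bar> * \<bar>d \<bullet> c\<bar> * \<bar>B x b c - B a b c\<bar> \<le> (norm d)\<^sup>2 * \<bar>B x b c - B a b c\<bar>"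
          by (simp add: power2_eq_square mult_right_mono)
        moreover have "(d \<bullet> b) *\<^sub>R (d \<bullet> c) *\<^sub>R (B a b c - B x b c) \<le> \<bar>d \<bullet> b\<bar> * \<bar>d \<bullet> c\<bar> * \<bar>B x b c - B a b c\<bar>"
          using abs_ge_self[of "(d \<bullet> b) * ((d \<bullet> c) * (B a b c - B x b c))"]
          by (simp add: abs_mult mult.assoc abs_minus_commute)
        ultimately show "(d \<bullet> b) *\<^sub>R (d \<bullet> c) *\<^sub>R (B a b c - B x b c) \<le> (norm d)\<^sup>2 * \<bar>B x b c - B a b c\<bar>"
          by linarith
      qed
      also have "\<dots> = (norm d)\<^sup>2 * E x" by (simp add: E_def sum_distrib_left)
      also have "\<dots> \<le> (norm d)\<^sup>2 * (m / 2)" using x(2) by (intro mult_left_mono) auto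
      finally have "m / 2 * (norm d)\<^sup>2 \<le> B x d d" using m(2)[of d] by (simp add: mult.commute)
      with 1 have "norm d * (m / 2 * norm d) \<le> norm d * F x" by (simp add: power2_eq_square mult.left_commute)
      moreover have "F x \<ge> 0" unfolding F_def by (intro sum_nonneg) auto
      ultimately have "m / 2 * norm d \<le> F x"
        by (cases "d = 0") auto
      then show ?thesis using m(1) by (simp add: d_def field_simps)
    qed
    have "\<forall>\<^sub>F x in at a. E x < m / 2"
      using order_tendstoD(2)[OF E0, of "m / 2"] m(1) by simp
    moreover have "\<forall>\<^sub>F x in at a. x \<in> S" using S a by (simp add: eventually_at_in_open')
    ultimately have "\<forall>\<^sub>F x in at a. norm (u x - u a) \<le> 2 / m * F x"
      by eventually_elim (rule bd)
    moreover have "((\<lambda>x. 2 / m * F x) \<longlongrightarrow> 0) (at a)"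
      using tendsto_mult_left[OF F0, of "2 / m"] by simp
    ultimately have "((\<lambda>x. u x - u a) \<longlongrightarrow> 0) (at a)" by (rule Lim_null_comparison)
    then show ?thesis by (rule Lim_null[THEN iffD2])
  qed
  then show ?thesis unfolding continuous_on_eq_continuous_at[OF S] continuous_at by blast
qed

text \<open>Moving all variation to the right side gives
  \<open>B a (u x - u a) b = r x \<bullet> b\<close> for basis vectors \<open>b\<close>. In
  \<open>r\<close> the unknown \<open>u x\<close> is multiplied only by increments of
  \<open>B\<close>, which vanish at \<open>a\<close>, so \<open>r\<close> is differentiable although
  \<open>u\<close> is only known to be continuous. Applying the inverse \<open>M\<close> of the
  fixed form \<open>B a\<close> recovers \<open>u\<close>. The second claim is the differentiated
  system.\<close>

lemma has_derivative_posdef_solution: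
  assumes cB: "\<And>v w. continuous_on S (\<lambda>x. B x v w)" and cK: "\<And>z. continuous_on S (\<lambda>x. K x z)"
    and u: "\<And>x z. x \<in> S \<Longrightarrow> B x (u x) z = K x z"
    and a: "a \<in> S" and dB: "\<And>v w. (\<lambda>x. B x v w) differentiable (at a)"
    and dK: "\<And>z. (\<lambda>x. K x z) differentiable (at a)"
  shows "u differentiable (at a)"
    and "B a (fderiv u a y) z = fderiv (\<lambda>x. K x z) a y - fderiv (\<lambda>x. B x (u a) z) a y"
proof -
  define L where "L u = (\<Sum>b\<in>Basis. B a u b *\<^sub>R b)" for u
  have L: "B a u z = L u \<bullet> z" for u z
    unfolding L_def using bil[OF a] by (intro linear_inner_eq) (simp add: bilinear_def)
  have linL: "linear L"
    unfolding L_def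
    by (rule linearI) (simp_all add: bilinear_ladd[OF bil[OF a]] bilinear_lmul[OF bil[OF a]]
        scaleR_add_left sum.distrib scaleR_sum_right)
  have injL: "inj L"
    using posdef_form_unique[OF bil[OF a] pos[OF a]] L by (metis injI)
  obtain M where M: "linear M" "\<And>v. M (L v) = v"
    using linear_injective_left_inverse[OF linL injL] unfolding fun_eq_iff o_def id_def by blast
  have bM: "bounded_linear M" using M(1) by (simp add: linear_conv_bounded_linear)
  define r where "r x = (\<Sum>b\<in>Basis. (K x b - K a b - (\<Sum>c\<in>Basis. (u x \<bullet> c) * (B x c b - B a c b))) *\<^sub>R b)" for x
  define r' where "r' y = (\<Sum>b\<in>Basis. (fderiv (\<lambda>x. K x b) a y
      - (\<Sum>c\<in>Basis. (u a \<bullet> c) * fderiv (\<lambda>x. B x c b) a y)) *\<^sub>R b)" for y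
  have expand1: "B x v b = (\<Sum>c\<in>Basis. (v \<bullet> c) * B x c b)" if "x \<in> S" for x v b
  proof -
    have "linear (\<lambda>v. B x v b)" using bil[OF that] by (simp add: bilinear_def)
    then show ?thesis by (rule linear_functional_expand)
  qed
  have "L (u x - u a) = r x" if x: "x \<in> S" for x
  proof (rule euclidean_eqI)
    fix b :: 'b assume b: "b \<in> Basis"
    have "L (u x - u a) \<bullet> b = B a (u x) b - B a (u a) b"
      by (simp add: L[symmetric] bilinear_lsub[OF bil[OF a]])
    also have "\<dots> = K x b - K a b - (B x (u x) b - B a (u x) b)"
      by (simp add: u x a)
    also have "B x (u x) b - B a (u x) b = (\<Sum>c\<in>Basis. (u x \<bullet> c) * (B x c b - B a c b))"
      by (simp add: expand1[OF x, of "u x"] expand1[OF a, of "u x"] sum_subtractf right_diff_distrib)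
    finally show "L (u x - u a) \<bullet> b = r x \<bullet> b"
      using b by (simp add: r_def)
  qed
  then have ux: "u a + M (r x) = u x" if "x \<in> S" for x
    using that M(2) by (metis add.commute diff_add_cancel)
  have cu: "continuous (at a) (\<lambda>x. u x \<bullet> c)" for c
    using continuous_on_posdef_solution[OF cB cK u] a S
    unfolding continuous_on_eq_continuous_at[OF S] by (intro continuous_intros) blast
  have "(r has_derivative r') (at a)"
    unfolding r_def r'_def
  proof (intro has_derivative_sum has_derivative_scaleR_left has_derivative_diff)
    show "((\<lambda>x. K x b - K a b) has_derivative fderiv (\<lambda>x. K x b) a) (at a)" for b
      using has_derivative_diff[OF has_derivative_fderiv[OF dK] has_derivative_const] by simp
    show "((\<lambda>x. (u x \<bullet> c) * (B x c b - B a c b)) has_derivative (\<lambda>y. (u a \<bullet> c) * fderiv (\<lambda>x. B x c b) a y)) (at a)" for b c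
      using has_derivative_diff[OF has_derivative_fderiv[OF dB] has_derivative_const]
      by (intro has_derivative_mult_vanishing[OF cu]) auto
  qed
  then have "((\<lambda>x. u a + M (r x)) has_derivative (\<lambda>y. 0 + M (r' y))) (at a)"
    by (intro has_derivative_add has_derivative_const bounded_linear.has_derivative[OF bM])
  then have D: "(u has_derivative (\<lambda>y. M (r' y))) (at a)"
    using has_derivative_transform_within_open[OF _ S a ux] by simp
  then show "u differentiable (at a)" by (auto simp: differentiable_def)
  have "L (M w) = w" for w
    using linear_injective_imp_surjective[OF linL injL refl] M(2) by (metis surjD)
  then have "B a (fderiv u a y) z = r' y \<bullet> z"
    by (simp add: fderiv_eqI[OF D] L)
  also have "\<dots> = fderiv (\<lambda>x. K x z) a y - fderiv (\<lambda>x. B x (u a) z) a y"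
  proof -
    \<comment> \<open>Linearity of \<open>K x\<close> is inherited from the system that it equals on
      \<open>S\<close>.\<close>
    have "K x z = (\<Sum>b\<in>Basis. (z \<bullet> b) * K x b)" if "x \<in> S" for x
    proof -
      have "linear (B x (u x))" using bil[OF that] by (simp add: bilinear_def)
      from linear_functional_expand[OF this, of z] show ?thesis by (simp add: u that)
    qed
    then have "fderiv (\<lambda>x. K x z) a = fderiv (\<lambda>x. \<Sum>b\<in>Basis. (z \<bullet> b) * K x b) a"
      by (intro fderiv_cong_open[OF S a])
    also have "\<dots> = (\<lambda>y. \<Sum>b\<in>Basis. (z \<bullet> b) * fderiv (\<lambda>x. K x b) a y)"
      by (rule fderiv_eqI) (intro has_derivative_sum has_derivative_mult_right has_derivative_fderiv dK)
    finally have 1: "fderiv (\<lambda>x. K x z) a y = (\<Sum>b\<in>Basis. (z \<bullet> b) * fderiv (\<lambda>x. K x b) a y)" by simp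
    have 2: "fderiv (\<lambda>x. B x (u a) z) a y
        = (\<Sum>b\<in>Basis. (z \<bullet> b) * (\<Sum>c\<in>Basis. (u a \<bullet> c) * fderiv (\<lambda>x. B x c b) a y))"
      by (subst fderiv_bilinear_family_expand[OF S a bil dB], assumption, subst sum.swap)
        (simp add: sum_distrib_left mult_ac)
    show ?thesis
      unfolding 1 2 r'_def
      by (simp add: inner_sum_left sum_subtractf[symmetric] right_diff_distrib[symmetric] inner_commute[of z] mult.commute)
  qed
  finally show "B a (fderiv u a y) z = fderiv (\<lambda>x. K x z) a y - fderiv (\<lambda>x. B x (u a) z) a y" .
qed

text \<open>The derivative of a solution solves a system with the same \<open>B\<close> and a new
  right-hand side, which is why the induction is over arbitrary \<open>K\<close>.\<close>

lemma Ck_on_posdef_solution: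
  assumes "\<And>v w. Ck_on k S (\<lambda>x. B x v w)" and "\<And>z. Ck_on k S (\<lambda>x. K x z)"
    and "\<And>x z. x \<in> S \<Longrightarrow> B x (u x) z = K x z"
  shows "Ck_on k S u"
  using assms
proof (induction k arbitrary: K u)
  case 0
  then show ?case using continuous_on_posdef_solution[of K u] by simp
next
  case (Suc k)
  have cB: "continuous_on S (\<lambda>x. B x v w)" and cK: "continuous_on S (\<lambda>x. K x z)" for v w z
    using Suc.prems(1,2) Ck_on_imp_continuous_on by blast+
  have dB: "(\<lambda>x. B x v w) differentiable (at x)" and dK: "(\<lambda>x. K x z) differentiable (at x)"
    if "x \<in> S" for x v w z
    using Suc.prems(1,2) that by simp_all
  note D = has_derivative_posdef_solution[OF cB cK Suc.prems(3)]
  \<comment> \<open>The new right-hand side contains \<open>u\<close> itself, so order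
    \<open>k\<close> is first obtained for \<open>u\<close> from the old system.\<close>
  have "Ck_on k S u"
    using Suc.prems by (intro Suc.IH[of K]) (auto intro: Ck_on_SucD simp del: Ck_on.simps)
  have "Ck_on k S (\<lambda>x. fderiv u x y)" for y
  proof (rule Suc.IH)
    show "Ck_on k S (\<lambda>x. B x v w)" for v w using Suc.prems(1) by (rule Ck_on_SucD)
    \<comment> \<open>The term in which the form is evaluated at the moving vector
      \<open>u x\<close> is expanded into products of scalar functions, to which the closure lemmas
      apply.\<close>
    show "B x (fderiv u x y) z = fderiv (\<lambda>x. K x z) x y
        + (\<Sum>b\<in>Basis. \<Sum>c\<in>Basis. - (z \<bullet> c) *\<^sub>R ((u x \<bullet> b) * fderiv (\<lambda>x. B x b c) x y))"
      if x: "x \<in> S" for x z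
    proof -
      have "B x (fderiv u x y) z = fderiv (\<lambda>x. K x z) x y - fderiv (\<lambda>x'. B x' (u x) z) x y"
        using x by (intro D(2) dB dK)
      moreover have "fderiv (\<lambda>x'. B x' (u x) z) x y =
          (\<Sum>b\<in>Basis. \<Sum>c\<in>Basis. (u x \<bullet> b) *\<^sub>R (z \<bullet> c) *\<^sub>R fderiv (\<lambda>x. B x b c) x y)"
        by (rule fderiv_bilinear_family_expand[OF S x bil dB[OF x]])
      ultimately show ?thesis by (simp add: sum_negf mult_ac)
    qed
    show "Ck_on k S (\<lambda>x. fderiv (\<lambda>x. K x z) x y
        + (\<Sum>b\<in>Basis. \<Sum>c\<in>Basis. - (z \<bullet> c) *\<^sub>R ((u x \<bullet> b) * fderiv (\<lambda>x. B x b c) x y)))" for z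
    proof (intro Ck_on_add Ck_on_sum S Ck_on_bounded_linear[OF S bounded_linear_scaleR_right]
        Ck_on_bounded_bilinear[OF S bounded_bilinear_mult])
      show "Ck_on k S (\<lambda>x. u x \<bullet> b)" for b
        by (rule Ck_on_bounded_linear[OF S bounded_linear_inner_left \<open>Ck_on k S u\<close>])
    qed (use Suc.prems(1,2) in simp_all)
  qed
  then show ?case using D(1)[OF _ _ dB dK] by simp
qed

end

section \<open>Naturality of the Ricci tensor\<close>

text \<open>A linear family becomes a bilinear one by adjoining a scalar argument, kept at
  1.\<close>

lemma has_derivative_linear_family:
  fixes L :: "'z::real_normed_vector \<Rightarrow> 'a::euclidean_space \<Rightarrow> 'c::real_normed_vector"
  assumes V: "open V" "x \<in> V" and lin: "\<And>z. z \<in> V \<Longrightarrow> linear (L z)"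
    and diff: "\<And>v. (\<lambda>z. L z v) differentiable (at x)" and p: "(p has_derivative p') (at x)"
  shows "((\<lambda>y. L y (p y)) has_derivative (\<lambda>u. fderiv (\<lambda>z. L z (p x)) x u + L x (p' u))) (at x)"
proof -
  have "bilinear (\<lambda>v (r::real). r *\<^sub>R L z v)" if "z \<in> V" for z
    using lin[OF that] unfolding bilinear_def
    by (auto intro!: linearI simp: linear_add linear_scale scaleR_add_right scaleR_add_left)
  then have "((\<lambda>y. 1 *\<^sub>R L y (p y)) has_derivative
      (\<lambda>u. fderiv (\<lambda>z. 1 *\<^sub>R L z (p x)) x u + 1 *\<^sub>R L x (p' u) + 0 *\<^sub>R L x (p x))) (at x)"
    using V diff p
    by (intro has_derivative_bilinear_family[where B = "\<lambda>z v r. r *\<^sub>R L z v" and f = "\<lambda>x. x" and V = V]) auto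
  then show ?thesis by simp
qed

text \<open>The Christoffel symbol of the first kind; \<open>christoffel\<close> raises its last
  index.\<close>

definition koszul ::
    "('a::euclidean_space \<Rightarrow> 'a \<Rightarrow> 'a \<Rightarrow> real) \<Rightarrow> 'a \<Rightarrow> 'a \<Rightarrow> 'a \<Rightarrow> 'a \<Rightarrow> real" where
  "koszul G x v w z =
     (fderiv (\<lambda>y. G y w z) x v + fderiv (\<lambda>y. G y v z) x w - fderiv (\<lambda>y. G y v w) x z) / 2"

text \<open>Higher regularity is left to the individual lemmas because it has two sources: for
  charts it comes from smoothness of the metric, for the toric metric from an explicit formula for
  the connection.\<close>

locale metric_patch =
  fixes S :: "'a::euclidean_space set" and G :: "'a \<Rightarrow> 'a \<Rightarrow> 'a \<Rightarrow> real"
  assumes open_dom: "open S"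
    and bilinear_metric: "\<And>x. x \<in> S \<Longrightarrow> bilinear (G x)"
    and metric_sym: "\<And>x v w. x \<in> S \<Longrightarrow> G x v w = G x w v"
    and metric_pos: "\<And>x v. x \<in> S \<Longrightarrow> v \<noteq> 0 \<Longrightarrow> G x v v > 0"
    and metric_differentiable: "\<And>x v w. x \<in> S \<Longrightarrow> (\<lambda>y. G y v w) differentiable (at x)"
begin

lemma bilinear_fderiv_metric: "x \<in> S \<Longrightarrow> bilinear (\<lambda>v w. fderiv (\<lambda>y. G y v w) x u)"
  by (rule bilinear_fderiv_family[OF open_dom _ bilinear_metric metric_differentiable])

lemma linear_fderiv_metric: "x \<in> S \<Longrightarrow> linear (fderiv (\<lambda>y. G y v w) x)"
  by (rule linear_frechet_derivative[OF metric_differentiable])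

lemma fderiv_metric_sym:
  assumes "x \<in> S" shows "fderiv (\<lambda>y. G y v w) x = fderiv (\<lambda>y. G y w v) x"
  by (rule fderiv_cong_open[OF open_dom assms metric_sym])

lemmas fderiv_metric_linear_simps =
  bilinear_ladd[OF bilinear_fderiv_metric] bilinear_radd[OF bilinear_fderiv_metric]
  bilinear_lmul[OF bilinear_fderiv_metric] bilinear_rmul[OF bilinear_fderiv_metric]
  linear_add[OF linear_fderiv_metric] linear_scale[OF linear_fderiv_metric]

lemma linear_koszul:
  assumes "x \<in> S" shows "linear (koszul G x v w)"
  by (rule linearI) (simp_all add: koszul_def fderiv_metric_linear_simps assms algebra_simps
      add_divide_distrib diff_divide_distrib)

lemma bilinear_koszul:
  assumes "x \<in> S" shows "bilinear (\<lambda>v w. koszul G x v w z)"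
  unfolding bilinear_def
  by (intro conjI allI linearI) (simp_all add: koszul_def fderiv_metric_linear_simps assms algebra_simps
      add_divide_distrib diff_divide_distrib)

lemma metric_eqI: "x \<in> S \<Longrightarrow> (\<And>z. G x u z = G x u' z) \<Longrightarrow> u = u'"
  using posdef_form_unique[OF bilinear_metric metric_pos] by blast

lemma christoffel_eqI:
  assumes "x \<in> S" "\<And>z. G x u z = koszul G x v w z"
  shows "christoffel G x v w = u"
  unfolding christoffel_def
proof (rule the_equality)
  show "\<forall>z. G x u z = (fderiv (\<lambda>y. G y w z) x v + fderiv (\<lambda>y. G y v z) x w - fderiv (\<lambda>y. G y v w) x z) / 2"
    using assms(2) by (simp add: koszul_def)
  show "u' = u"
    if "\<forall>z. G x u' z = (fderiv (\<lambda>y. G y w z) x v + fderiv (\<lambda>y. G y v z) x w - fderiv (\<lambda>y. G y v w) x z) / 2" for u'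
  proof (rule metric_eqI[OF assms(1)])
    show "G x u' z = G x u z" for z
      using spec[OF that, of z] assms(2)[of z] by (simp add: koszul_def)
  qed
qed

lemma metric_christoffel:
  assumes "x \<in> S"
  shows "G x (christoffel G x v w) z = koszul G x v w z"
proof -
  obtain u where "\<forall>z. G x u z = koszul G x v w z"
    using posdef_form_solve[OF bilinear_metric[OF assms] metric_pos[OF assms] linear_koszul[OF assms]] by blast
  then show ?thesis using christoffel_eqI[OF assms] by metis
qed

lemma christoffel_sym: "x \<in> S \<Longrightarrow> christoffel G x v w = christoffel G x w v"
  by (rule christoffel_eqI) (simp_all add: metric_christoffel koszul_def fderiv_metric_sym[of x v w])

lemma bilinear_christoffel:
  assumes x: "x \<in> S" shows "bilinear (christoffel G x)"
proof -
  note simps = metric_christoffel[OF x] bilinear_ladd[OF bilinear_metric[OF x]] bilinear_lmul[OF bilinear_metric[OF x]]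
    bilinear_ladd[OF bilinear_koszul[OF x]] bilinear_lmul[OF bilinear_koszul[OF x]]
    bilinear_radd[OF bilinear_koszul[OF x]] bilinear_rmul[OF bilinear_koszul[OF x]]
  show ?thesis
    unfolding bilinear_def
    by (intro conjI allI linearI christoffel_eqI[OF x]; simp add: simps)
qed

text \<open>The connection solves a positive definite system with form \<open>G\<close>; one order
  is lost because \<open>koszul\<close> contains first derivatives of \<open>G\<close>.\<close>

lemma Ck_on_christoffel:
  assumes "\<And>v w. Ck_on (Suc k) S (\<lambda>y. G y v w)"
  shows "Ck_on k S (\<lambda>y. christoffel G y v w)"
proof (rule Ck_on_posdef_solution[OF open_dom bilinear_metric metric_pos])
  show "Ck_on k S (\<lambda>x. G x v w)" for v w using assms by (rule Ck_on_SucD)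
  show "G x (christoffel G x v w) z = (1/2) *\<^sub>R (fderiv (\<lambda>y. G y w z) x v + fderiv (\<lambda>y. G y v z) x w + (-1) *\<^sub>R fderiv (\<lambda>y. G y v w) x z)"
    if "x \<in> S" for x z
    using that by (simp add: metric_christoffel koszul_def)
  show "Ck_on k S (\<lambda>x. (1/2) *\<^sub>R (fderiv (\<lambda>y. G y w z) x v + fderiv (\<lambda>y. G y v z) x w + (-1) *\<^sub>R fderiv (\<lambda>y. G y v w) x z))" for z
    using assms by (intro Ck_on_bounded_linear[OF open_dom bounded_linear_scaleR_right] Ck_on_add open_dom) simp_all
qed

text \<open>Linearity in the traced slot is what makes the trace over \<open>Basis\<close>
  independent of coordinates.\<close>

lemma linear_riemann:
  assumes x: "x \<in> S" and d: "\<And>v w. (\<lambda>y. christoffel G y v w) differentiable (at x)"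
  shows "linear (\<lambda>u. riemann G x u v w)"
proof -
  have 1: "linear (fderiv (\<lambda>y. christoffel G y v w) x)"
    by (rule linear_frechet_derivative[OF d])
  have "bilinear (\<lambda>p q. fderiv (\<lambda>y. christoffel G y p q) x v)"
    by (rule bilinear_fderiv_family[OF open_dom x bilinear_christoffel d])
  then have 2: "linear (\<lambda>u. fderiv (\<lambda>y. christoffel G y u w) x v)" by (simp add: bilinear_def)
  have 3: "linear (\<lambda>u. christoffel G x u p)" "linear (christoffel G x p)" for p
    using bilinear_christoffel[OF x] by (simp_all add: bilinear_def)
  show ?thesis
    unfolding riemann_def
    by (intro linear_compose_sub linear_compose_add 1 2 3 linear_compose[OF 3(1) 3(2), unfolded o_def])
qed

text \<open>Needed to extend the Einstein equation from a dense set. The nested connection term has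
  a moving argument and is therefore expanded in the basis.\<close>

lemma continuous_on_ricci:
  assumes "\<And>v w. Ck_on 1 S (\<lambda>y. christoffel G y v w)"
  shows "continuous_on S (\<lambda>x. ricci G x v w)"
proof -
  have c0: "continuous_on S (\<lambda>y. christoffel G y v w)" for v w
    using assms by (rule Ck_on_imp_continuous_on)
  have c1: "continuous_on S (\<lambda>y. fderiv (\<lambda>y. christoffel G y v w) y u)" for u v w
    using assms by simp
  have "continuous_on S (\<lambda>y. christoffel G y u (christoffel G y v w))" for u v w
  proof -
    have "continuous_on S (\<lambda>y. \<Sum>b\<in>Basis. \<Sum>c\<in>Basis. (u \<bullet> b) *\<^sub>R (christoffel G y v w \<bullet> c) *\<^sub>R christoffel G y b c)"
      by (intro continuous_intros c0)
    then show ?thesis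
      by (rule continuous_on_eq) (rule bilinear_expand[OF bilinear_christoffel, symmetric])
  qed
  then show ?thesis
    unfolding ricci_def riemann_def by (intro continuous_intros c1)
qed

end

text \<open>\<open>f\<close> is a local isometry: positivity of \<open>G\<close> makes its
  differential injective, and equality of dimensions makes it bijective. Global injectivity would
  exclude parametrizations that are periodic in the angles.\<close>

locale metric_pullback = W: metric_patch W G + V: metric_patch V g
  for W :: "'a::euclidean_space set" and G and V :: "'b::euclidean_space set" and g +
  fixes f :: "'a \<Rightarrow> 'b"
  assumes maps: "\<And>x. x \<in> W \<Longrightarrow> f x \<in> V"
    and smooth: "smooth_on W f"
    and pullback: "\<And>x v w. x \<in> W \<Longrightarrow> G x v w = g (f x) (fderiv f x v) (fderiv f x w)"
    and dim_eq: "DIM('a) = DIM('b)"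
begin

abbreviation "df \<equiv> fderiv f"
abbreviation d2f where "d2f x u v \<equiv> fderiv (\<lambda>y. df y v) x u"
abbreviation d3f where "d3f x u v w \<equiv> fderiv (\<lambda>y. d2f y v w) x u"

lemma differentiable_f:
  assumes "x \<in> W"
  shows "f differentiable (at x)" "(\<lambda>y. df y v) differentiable (at x)" "(\<lambda>y. d2f y v w) differentiable (at x)"
  using smooth smooth_on_fderiv[OF smooth, of v] smooth_on_fderiv[OF smooth_on_fderiv[OF smooth, of w], of v]
    assms smooth_on_differentiable by blast+

lemma linear_df: "x \<in> W \<Longrightarrow> linear (df x)"
  by (rule linear_frechet_derivative[OF differentiable_f(1)])

lemma inj_df:
  assumes x: "x \<in> W" shows "inj (df x)"
proof -
  have "v = 0" if "df x v = 0" for v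
    using that W.metric_pos[OF x, of v] pullback[OF x, of v v] bilinear_lzero[OF V.bilinear_metric[OF maps[OF x]]]
    by (metis less_irrefl)
  then show ?thesis using linear_injective_0[OF linear_df[OF x]] by blast
qed

lemma surj_df:
  assumes x: "x \<in> W" shows "surj (df x)"
  using linear_injective_imp_surjective[OF linear_df[OF x] inj_df[OF x]] dim_eq by simp

lemma d2f_sym: "x \<in> W \<Longrightarrow> d2f x u v = d2f x v u"
  using fderiv_fderiv_commute[OF W.open_dom _ differentiable_f(1,2,2)] by blast

lemma d3f_sym: "x \<in> W \<Longrightarrow> d3f x u v w = d3f x v u w"
  using fderiv_fderiv_commute[OF W.open_dom _ differentiable_f(2,3,3)] by blast

lemma fderiv_pullback:
  assumes x: "x \<in> W"
  shows "fderiv (\<lambda>y. G y v w) x u =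
    fderiv (\<lambda>z. g z (df x v) (df x w)) (f x) (df x u) + g (f x) (d2f x u v) (df x w) + g (f x) (df x v) (d2f x u w)"
proof -
  have "((\<lambda>y. g (f y) (df y v) (df y w)) has_derivative
     (\<lambda>u. fderiv (\<lambda>z. g z (df x v) (df x w)) (f x) (df x u) + g (f x) (d2f x u v) (df x w)
        + g (f x) (df x v) (d2f x u w))) (at x)"
    using x maps V.metric_differentiable
    by (intro has_derivative_bilinear_family[OF V.open_dom _ V.bilinear_metric] has_derivative_fderiv
        differentiable_f) auto
  from has_derivative_transform_within_open[OF this W.open_dom x pullback[symmetric]]
  show ?thesis by (simp add: fderiv_eqI)
qed

text \<open>In the Koszul formula for \<open>G\<close> the three differentiated pullbacks produce
  six terms with second derivatives of \<open>f\<close>. By symmetry four cancel and two coincide,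
  leaving \<open>d2f x v w\<close>. Surjectivity of the differential makes the tested vectors
  exhaust the target.\<close>

lemma christoffel_pullback:
  assumes x: "x \<in> W"
  shows "christoffel g (f x) (df x v) (df x w) = df x (christoffel G x v w) - d2f x v w"
proof (rule V.christoffel_eqI[OF maps[OF x]])
  fix z'
  obtain z where z: "z' = df x z" using surj_df[OF x] by (metis surjD)
  have fx: "f x \<in> V" by (rule maps[OF x])
  have "g (f x) (df x (christoffel G x v w) - d2f x v w) z' = koszul G x v w z - g (f x) (d2f x v w) (df x z)"
    by (simp add: z bilinear_lsub[OF V.bilinear_metric[OF fx]] pullback[OF x, symmetric] W.metric_christoffel[OF x])
  also have "\<dots> = koszul g (f x) (df x v) (df x w) z'"
    unfolding koszul_def z fderiv_pullback[OF x]
    by (simp add: d2f_sym[OF x, of w v] d2f_sym[OF x, of z] V.metric_sym[OF fx, of _ "d2f x _ _"] field_simps)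
  finally show "g (f x) (df x (christoffel G x v w) - d2f x v w) z' = koszul g (f x) (df x v) (df x w) z'" .
qed

context
  assumes dW: "\<And>x v w. x \<in> W \<Longrightarrow> (\<lambda>y. christoffel G y v w) differentiable (at x)"
    and dV: "\<And>z v w. z \<in> V \<Longrightarrow> (\<lambda>y. christoffel g y v w) differentiable (at z)"
begin

text \<open>Both sides of \<open>christoffel_pullback\<close> are differentiated along
  \<open>u\<close>; on the left the base point and both arguments move, whence the corrections by
  \<open>d2f\<close>.\<close>

lemma fderiv_christoffel_pullback:
  assumes x: "x \<in> W"
  shows "fderiv (\<lambda>z. christoffel g z (df x v) (df x w)) (f x) (df x u) =
    d2f x u (christoffel G x v w) + df x (fderiv (\<lambda>y. christoffel G y v w) x u) - d3f x u v w
    - christoffel g (f x) (d2f x u v) (df x w) - christoffel g (f x) (df x v) (d2f x u w)"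
proof -
  have fx: "f x \<in> V" by (rule maps[OF x])
  have "((\<lambda>y. christoffel g (f y) (df y v) (df y w)) has_derivative
     (\<lambda>u. fderiv (\<lambda>z. christoffel g z (df x v) (df x w)) (f x) (df x u)
        + christoffel g (f x) (d2f x u v) (df x w) + christoffel g (f x) (df x v) (d2f x u w))) (at x)"
    using x fx dV
    by (intro has_derivative_bilinear_family[OF V.open_dom _ V.bilinear_christoffel] has_derivative_fderiv
        differentiable_f) auto
  note 1 = has_derivative_transform_within_open[OF this W.open_dom x christoffel_pullback]
  have "((\<lambda>y. df y (christoffel G y v w)) has_derivative
     (\<lambda>u. d2f x u (christoffel G x v w) + df x (fderiv (\<lambda>y. christoffel G y v w) x u))) (at x)"
    by (rule has_derivative_linear_family[OF W.open_dom x linear_df differentiable_f(2)[OF x]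
          has_derivative_fderiv[OF dW[OF x]]])
  note 2 = has_derivative_diff[OF this has_derivative_fderiv[OF differentiable_f(3)[OF x]]]
  from fun_cong[OF has_derivative_unique[OF 1 2], of u] show ?thesis by (simp add: algebra_simps)
qed

text \<open>Antisymmetrization in \<open>u\<close> and \<open>v\<close> removes \<open>d3f\<close>
  and the terms containing \<open>d2f x u v\<close>; the other second derivatives cancel against
  those from the nested connection terms.\<close>

lemma riemann_pullback:
  assumes x: "x \<in> W"
  shows "riemann g (f x) (df x u) (df x v) (df x w) = df x (riemann G x u v w)"
proof -
  have fx: "f x \<in> V" by (rule maps[OF x])
  have 1: "christoffel g (f x) (df x u) (christoffel g (f x) (df x v) (df x w)) =
      df x (christoffel G x u (christoffel G x v w)) - d2f x u (christoffel G x v w)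
      - christoffel g (f x) (df x u) (d2f x v w)" for u v
    by (simp add: christoffel_pullback[OF x] bilinear_rsub[OF V.bilinear_christoffel[OF fx]])
  show ?thesis
    unfolding riemann_def fderiv_christoffel_pullback[OF x] 1
    by (simp add: linear_add[OF linear_df[OF x]] linear_diff[OF linear_df[OF x]]
        d3f_sym[OF x, where u = u and v = v] d2f_sym[OF x, where u = u and v = v] V.christoffel_sym[OF fx, of "df x _" "d2f x _ _"])
qed

end

end

text \<open>With \<open>R\<close> the inverse of \<open>T\<close>, this is cyclicity of the trace
  for \<open>T\<close>, \<open>L\<close> and \<open>R\<close>, carried out as an exchange of two
  sums because the spaces differ.\<close>

lemma trace_conjugate:
  fixes T :: "'a::euclidean_space \<Rightarrow> 'b::euclidean_space"
  assumes T: "linear T" "inj T" "surj T" and L: "linear L" and conj: "\<And>u. L' (T u) = T (L u)"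
  shows "(\<Sum>b\<in>Basis. L' b \<bullet> b) = (\<Sum>b\<in>Basis. L b \<bullet> b)"
proof -
  obtain R where R: "linear R" "\<And>x. R (T x) = x"
    using linear_injective_left_inverse[OF T(1,2)] unfolding fun_eq_iff o_def id_def by blast
  have TR: "T (R y) = y" for y using surjD[OF T(3), of y] R(2) by auto
  have lin: "linear (\<lambda>u. T (L u) \<bullet> c)" for c
    by (auto intro!: linearI simp: linear_add[OF L] linear_scale[OF L] linear_add[OF T(1)] linear_scale[OF T(1)]
        inner_add_left)
  have "(\<Sum>c\<in>Basis. L' c \<bullet> c) = (\<Sum>c\<in>Basis. T (L (R c)) \<bullet> c)"
    by (simp only: conj[symmetric] TR)
  also have "\<dots> = (\<Sum>c\<in>Basis. \<Sum>b\<in>Basis. (R c \<bullet> b) * (T (L b) \<bullet> c))"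
    by (intro sum.cong refl linear_functional_expand[OF lin])
  also have "\<dots> = (\<Sum>b\<in>Basis. \<Sum>c\<in>Basis. (T (L b) \<bullet> c) * (R c \<bullet> b))"
    by (subst sum.swap) (simp add: mult.commute)
  also have "\<dots> = (\<Sum>b\<in>Basis. R (T (L b)) \<bullet> b)"
  proof (intro sum.cong refl, rule linear_functional_expand[symmetric])
    show "linear (\<lambda>c. R c \<bullet> b)" for b
      by (auto intro!: linearI simp: linear_add[OF R(1)] linear_scale[OF R(1)] inner_add_left)
  qed
  finally show ?thesis by (simp add: R)
qed

lemma (in metric_pullback) ricci_pullback:
  assumes dW: "\<And>x v w. x \<in> W \<Longrightarrow> (\<lambda>y. christoffel G y v w) differentiable (at x)"
    and dV: "\<And>z v w. z \<in> V \<Longrightarrow> (\<lambda>y. christoffel g y v w) differentiable (at z)"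
    and x: "x \<in> W"
  shows "ricci g (f x) (df x v) (df x w) = ricci G x v w"
proof -
  have "linear (\<lambda>u. riemann G x u v w)"
    by (rule W.linear_riemann[OF x dW[OF x]])
  moreover have "riemann g (f x) (df x u) (df x v) (df x w) = df x (riemann G x u v w)" for u
    using dW dV x by (rule riemann_pullback)
  ultimately show ?thesis
    unfolding ricci_def by (rule trace_conjugate[OF linear_df[OF x] inj_df[OF x] surj_df[OF x]])
qed

section \<open>Hessian metrics\<close>

lemma bounded_bilinear_matrix_vector_mult:
  "bounded_bilinear ((*v) :: real^'n^'m \<Rightarrow> real^'n \<Rightarrow> real^'m)"
  unfolding bilinear_conv_bounded_bilinear[symmetric] bilinear_def
  by (auto intro!: linearI simp: matrix_vector_mult_add_rdistrib scaleR_matrix_vector_assoc)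

lemma bounded_bilinear_matrix_matrix_mult:
  "bounded_bilinear ((**) :: real^'n^'m \<Rightarrow> real^'k^'n \<Rightarrow> real^'k^'m)"
  unfolding bilinear_conv_bounded_bilinear[symmetric] bilinear_def
  by (auto intro!: linearI simp: vec_eq_iff matrix_matrix_mult_def sum.distrib algebra_simps sum_distrib_left)

lemma linear_trace: "linear (trace :: real^'n^'n \<Rightarrow> real)"
  by (rule linearI) (simp_all add: trace_def sum.distrib sum_distrib_left)

lemma sum_matrix_axis: "(\<Sum>i\<in>UNIV. (M *v axis i 1) $ i) = trace (M :: real^'n^'n)"
  by (simp add: trace_def matrix_vector_mult_basis column_def)

lemma sum_Basis_vec: "(\<Sum>b\<in>(Basis :: (real^'n) set). F b) = (\<Sum>i\<in>UNIV. F (axis i 1))"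
  unfolding Basis_vec_def
  by (simp add: UNION_singleton_eq_range sum.reindex inj_on_def axis_eq_axis)

lemma inner_symmetric_matrix:
  fixes M :: "real^'n^'n"
  assumes "transpose M = M"
  shows "v \<bullet> (M *v w) = (M *v v) \<bullet> w"
  using dot_lmul_matrix[of v M w] assms vector_transpose_matrix[of v M] by simp

text \<open>In the Leibniz expansion a permutation other than the identity moves at least two
  indices. After one factor is differentiated, an off-diagonal entry of the identity matrix still
  remains, so only the diagonal term contributes.\<close>

lemma has_derivative_det_at_mat_1:
  fixes A :: "'a::real_normed_vector \<Rightarrow> real^'n^'n"
  assumes A: "(A has_derivative A') (at x)" and id: "A x = mat 1"
  shows "((\<lambda>y. det (A y)) has_derivative (\<lambda>u. trace (A' u))) (at x)"
proof -
  have entry: "((\<lambda>y. A y $ i $ j) has_derivative (\<lambda>u. A' u $ i $ j)) (at x)" for i j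
    by (intro bounded_linear.has_derivative[OF bounded_linear_vec_nth] A)
  have D: "((\<lambda>y. det (A y)) has_derivative (\<lambda>u. \<Sum>p\<in>{p. p permutes UNIV}. of_int (sign p) *
      (\<Sum>i\<in>UNIV. A' u $ i $ p i * (\<Prod>j\<in>UNIV - {i}. A x $ j $ p j)))) (at x)"
    unfolding det_def by (intro has_derivative_sum has_derivative_mult_right has_derivative_prod entry)
  have "(\<Sum>p\<in>{p. p permutes (UNIV::'n set)}. of_int (sign p) *
      (\<Sum>i\<in>UNIV. A' u $ i $ p i * (\<Prod>j\<in>UNIV - {i}. A x $ j $ p j))) = trace (A' u)" for u
  proof -
    have prod0: "(\<Prod>j\<in>UNIV - {i}. A x $ j $ p j) = 0" if p: "p permutes (UNIV::'n set)" "p \<noteq> id" for p i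
    proof -
      obtain k where k: "p k \<noteq> k" using p(2) by (auto simp: fun_eq_iff)
      \<comment> \<open>Both \<open>k\<close> and \<open>p k\<close> are moved, and at least one of
        them differs from the omitted index \<open>i\<close>.\<close>
      then have "p (p k) \<noteq> p k" using permutes_inj[OF p(1)] by (auto dest: injD)
      then obtain j where "j \<noteq> i" "p j \<noteq> j" using k by metis
      then show ?thesis by (intro prod_zero) (auto intro!: bexI[of _ j] simp: id mat_def)
    qed
    have zero: "(\<Sum>i\<in>UNIV. A' u $ i $ p i * (\<Prod>j\<in>UNIV - {i}. A x $ j $ p j)) = 0"
      if "p permutes (UNIV::'n set)" "p \<noteq> id" for p
      by (intro sum.neutral ballI) (simp only: prod0[OF that] mult_zero_right)
    have "(\<Sum>p\<in>{p. p permutes (UNIV::'n set)}. of_int (sign p) *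
        (\<Sum>i\<in>UNIV. A' u $ i $ p i * (\<Prod>j\<in>UNIV - {i}. A x $ j $ p j)))
      = (\<Sum>p\<in>{id}. of_int (sign p) * (\<Sum>i\<in>UNIV. A' u $ i $ p i * (\<Prod>j\<in>UNIV - {i}. A x $ j $ p j)))"
    proof (rule sum.mono_neutral_right)
      show "\<forall>p\<in>{p. p permutes (UNIV::'n set)} - {id}. of_int (sign p) *
          (\<Sum>i\<in>UNIV. A' u $ i $ p i * (\<Prod>j\<in>UNIV - {i}. A x $ j $ p j)) = 0"
        by (intro ballI, subst zero) auto
    qed (auto simp: permutes_id finite_permutations)
    also have "\<dots> = trace (A' u)"
      by (simp add: trace_def sign_id id mat_def)
    finally show ?thesis .
  qed
  with D show ?thesis by simp
qed

text \<open>Jacobi's formula, reduced to the identity matrix by factoring \<open>det (A y)\<close>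
  as \<open>det (A x) * det (B ** A y)\<close>.\<close>

lemma has_derivative_det:
  fixes A :: "'a::real_normed_vector \<Rightarrow> real^'n^'n"
  assumes A: "(A has_derivative A') (at x)" and B: "A x ** B = mat 1"
  shows "((\<lambda>y. det (A y)) has_derivative (\<lambda>u. det (A x) * trace (B ** A' u))) (at x)"
proof -
  have BA: "B ** A x = mat 1" using B by (simp add: matrix_left_right_inverse)
  have "((\<lambda>y. det (A x) * det (B ** A y)) has_derivative (\<lambda>u. det (A x) * trace (B ** A' u))) (at x)"
    using bounded_bilinear.FDERIV[OF bounded_bilinear_matrix_matrix_mult has_derivative_const A, of B]
    by (intro has_derivative_mult_right has_derivative_det_at_mat_1 BA) simp
  moreover have "det (A x) * det (B ** A y) = det (A y)" for y
    using B by (metis det_I det_mul matrix_mul_assoc matrix_mul_lid)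
  ultimately show ?thesis by simp
qed

lemma differentiable_matrixI:
  fixes A :: "'a::real_normed_vector \<Rightarrow> real^'n^'m"
  assumes "\<And>i j. (\<lambda>y. A y $ i $ j) differentiable (at x)"
  shows "A differentiable (at x)"
proof -
  have "(\<lambda>y. A y \<bullet> b) differentiable (at x)" if b: "b \<in> Basis" for b
  proof -
    obtain i j where "b = axis i (axis j 1)" using b unfolding Basis_vec_def by auto
    then show ?thesis using assms by (simp add: inner_axis)
  qed
  then show ?thesis unfolding differentiable_componentwise_within[of A] by blast
qed

text \<open>\<open>S\<close> stands for the Hessian and \<open>H\<close> for \<open>h\<close>. The
  condition \<open>codazzi\<close> is the symmetry of the third derivatives of the potential and the
  form in which the potential enters the curvature computation.\<close>

locale hessian_patch =
  fixes U :: "(real^'n) set" and S H :: "real^'n \<Rightarrow> real^'n^'n"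
  assumes open_U: "open U"
    and S_differentiable: "\<And>x. x \<in> U \<Longrightarrow> S differentiable (at x)"
    and dS_differentiable: "\<And>x a. x \<in> U \<Longrightarrow> (\<lambda>y. fderiv S y a) differentiable (at x)"
    and S_sym: "\<And>x. x \<in> U \<Longrightarrow> transpose (S x) = S x"
    and S_pos: "\<And>x v. x \<in> U \<Longrightarrow> v \<noteq> 0 \<Longrightarrow> v \<bullet> (S x *v v) > 0"
    and inverse: "\<And>x. x \<in> U \<Longrightarrow> S x ** H x = mat 1"
    and codazzi: "\<And>x a c. x \<in> U \<Longrightarrow> fderiv S x a *v c = fderiv S x c *v a"
begin

abbreviation "T \<equiv> fderiv S"
abbreviation Q where "Q x u a \<equiv> fderiv (\<lambda>y. T y a) x u"

lemma inverse': "x \<in> U \<Longrightarrow> H x ** S x = mat 1"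
  using inverse by (simp add: matrix_left_right_inverse)

lemma HS: "x \<in> U \<Longrightarrow> H x *v (S x *v v) = v" and SH: "x \<in> U \<Longrightarrow> S x *v (H x *v v) = v"
  by (simp_all add: matrix_vector_mul_assoc inverse inverse')

lemma H_sym: "x \<in> U \<Longrightarrow> transpose (H x) = H x"
proof -
  assume x: "x \<in> U"
  have "transpose (H x) = transpose (H x) ** (S x ** H x)" by (simp add: inverse[OF x])
  also have "\<dots> = transpose (S x ** H x) ** H x"
    by (simp add: matrix_transpose_mul S_sym[OF x] matrix_mul_assoc)
  also have "\<dots> = H x" by (simp add: inverse[OF x] transpose_mat)
  finally show ?thesis .
qed

lemma H_pos:
  assumes "x \<in> U" "v \<noteq> 0" shows "v \<bullet> (H x *v v) > 0"
proof -
  have "H x *v v \<noteq> 0" using SH[OF assms(1), of v] assms(2) by auto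
  from S_pos[OF assms(1) this] show ?thesis by (simp add: SH[OF assms(1)] inner_commute)
qed

lemma linear_T: "x \<in> U \<Longrightarrow> linear (T x)"
  by (rule linear_frechet_derivative[OF S_differentiable])

lemmas T_simps = linear_add[OF linear_T] linear_scale[OF linear_T] linear_neg[OF linear_T] linear_diff[OF linear_T]

lemma T_sym:
  assumes x: "x \<in> U" shows "transpose (T x a) = T x a"
proof -
  have "linear (transpose :: real^'n^'n \<Rightarrow> _)" by (rule linearI) (simp_all add: vec_eq_iff transpose_def)
  then have "bounded_linear (transpose :: real^'n^'n \<Rightarrow> _)" by (simp add: linear_conv_bounded_linear)
  then have "((\<lambda>y. transpose (S y)) has_derivative (\<lambda>u. transpose (T x u))) (at x)"
    by (rule bounded_linear.has_derivative[OF _ has_derivative_fderiv[OF S_differentiable[OF x]]])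
  from fderiv_eqI[OF has_derivative_transform_within_open[OF this open_U x S_sym]]
  show ?thesis by (rule fun_cong[symmetric])
qed

lemma Q_sym: "x \<in> U \<Longrightarrow> Q x u a = Q x a u"
  using fderiv_fderiv_commute[OF open_U _ S_differentiable dS_differentiable dS_differentiable] by blast

text \<open>Differentiating \<open>codazzi\<close> along \<open>u\<close>. Together with
  \<open>Q_sym\<close> this makes \<open>Q x u a *v c\<close> symmetric in all three
  arguments.\<close>

lemma Q_codazzi:
  assumes x: "x \<in> U" shows "Q x u a *v c = Q x u c *v a"
proof -
  have D: "((\<lambda>y. T y a *v c) has_derivative (\<lambda>u. Q x u a *v c)) (at x)" for a c
    using bounded_bilinear.FDERIV[OF bounded_bilinear_matrix_vector_mult
        has_derivative_fderiv[OF dS_differentiable[OF x]] has_derivative_const[of c]] by simp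
  have "((\<lambda>y. T y c *v a) has_derivative (\<lambda>u. Q x u a *v c)) (at x)"
    by (rule has_derivative_transform_within_open[OF D[of a c] open_U x codazzi])
  from fun_cong[OF has_derivative_unique[OF this D]] show ?thesis .
qed

text \<open>Differentiability is assumed for \<open>S\<close> only. The vector
  \<open>H y *v w\<close> solves the positive definite system given by \<open>S y\<close> with
  constant right-hand side, hence is differentiable in \<open>y\<close>; the formula then follows by
  differentiating \<open>S y ** H y = mat 1\<close>.\<close>

lemma has_derivative_H:
  assumes x: "x \<in> U"
  shows "(H has_derivative (\<lambda>u. - (H x ** T x u ** H x))) (at x)"
proof -
  have bil: "bilinear (\<lambda>v w. v \<bullet> (S y *v w))" for y
    unfolding bilinear_def by (auto intro!: linearI simp: inner_add_left inner_add_right algebra_simps)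
  have dB: "(\<lambda>y. v \<bullet> (S y *v w)) differentiable (at y)" if "y \<in> U" for y v w
    using has_derivative_inner_right[OF bounded_bilinear.FDERIV[OF bounded_bilinear_matrix_vector_mult
        has_derivative_fderiv[OF S_differentiable[OF that]] has_derivative_const[of w]]]
    by (auto simp: differentiable_def)
  have cB: "continuous_on U (\<lambda>y. v \<bullet> (S y *v w))" for v w
    using dB by (auto intro!: continuous_at_imp_continuous_on differentiable_imp_continuous_within)
  have d: "(\<lambda>y. H y *v w) differentiable (at x)" for w
  proof (rule has_derivative_posdef_solution(1)[OF open_U bil S_pos cB _ _ x dB[OF x]])
    show "(H y *v w) \<bullet> (S y *v z) = w \<bullet> z" if "y \<in> U" for y z
      using that by (simp add: inner_symmetric_matrix S_sym SH)
  qed auto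
  have "(\<lambda>y. H y $ i $ j) differentiable (at x)" for i j
  proof -
    have "(\<lambda>y. (H y *v axis j 1) \<bullet> axis i 1) differentiable (at x)"
      using has_derivative_inner_left[OF has_derivative_fderiv[OF d]] by (auto simp: differentiable_def)
    then show ?thesis by (simp add: inner_axis matrix_vector_mult_basis column_def)
  qed
  then have "H differentiable (at x)" by (rule differentiable_matrixI)
  then have H: "(H has_derivative fderiv H x) (at x)" by (rule has_derivative_fderiv)
  have "((\<lambda>y. S y ** H y) has_derivative (\<lambda>u. S x ** fderiv H x u + T x u ** H x)) (at x)"
    by (intro bounded_bilinear.FDERIV[OF bounded_bilinear_matrix_matrix_mult] H
        has_derivative_fderiv S_differentiable x)
  moreover have "((\<lambda>y. S y ** H y) has_derivative (\<lambda>u. 0)) (at x)"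
    by (rule has_derivative_transform_within_open[OF has_derivative_const open_U x inverse[symmetric]])
  ultimately have 0: "S x ** fderiv H x u + T x u ** H x = 0" for u
    using fun_cong[OF has_derivative_unique] by blast
  have "fderiv H x u = - (H x ** T x u ** H x)" for u
  proof -
    have "fderiv H x u + H x ** T x u ** H x = H x ** (S x ** fderiv H x u + T x u ** H x)"
      by (simp add: matrix_add_ldistrib matrix_mul_assoc inverse'[OF x])
    also have "\<dots> = 0" unfolding 0 by (simp add: vec_eq_iff matrix_matrix_mult_def)
    finally show ?thesis by (rule eq_neg_iff_add_eq_0[THEN iffD2])
  qed
  then have "fderiv H x = (\<lambda>u. - (H x ** T x u ** H x))" by blast
  with H show ?thesis by simp
qed

end

section \<open>The Ricci tensor of a toric metric\<close>

lemma matrix_vector_mult_uminus_left: "(- A) *v x = - (A *v (x :: real^'n))"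
  by (simp add: vec_eq_iff matrix_vector_mult_def sum_negf)

context hessian_patch
begin

definition toric_metric :: "(real^'n) \<times> (real^'n) \<Rightarrow> (real^'n) \<times> (real^'n) \<Rightarrow> (real^'n) \<times> (real^'n) \<Rightarrow> real" where
  "toric_metric z v w = fst v \<bullet> (S (fst z) *v fst w) + snd v \<bullet> (H (fst z) *v snd w)"

lemma has_derivative_mult_H_vec:
  assumes x: "x \<in> U" and p: "(p has_derivative p') (at x)"
  shows "((\<lambda>y. H y *v p y) has_derivative (\<lambda>u. H x *v (p' u - T x u *v (H x *v p x)))) (at x)"
  using bounded_bilinear.FDERIV[OF bounded_bilinear_matrix_vector_mult has_derivative_H[OF x] p]
  by (simp add: matrix_vector_mult_diff_distrib matrix_vector_mul_assoc matrix_mul_assoc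
      matrix_vector_mult_uminus_left)

lemma has_derivative_T_vec:
  assumes x: "x \<in> U" and p: "(p has_derivative p') (at x)" and q: "(q has_derivative q') (at x)"
  shows "((\<lambda>y. T y (p y) *v q y) has_derivative
    (\<lambda>u. Q x u (p x) *v q x + T x (p' u) *v q x + T x (p x) *v q' u)) (at x)"
  using bounded_bilinear.FDERIV[OF bounded_bilinear_matrix_vector_mult
      has_derivative_linear_family[OF open_U x linear_T dS_differentiable[OF x] p] q]
  by (simp add: matrix_vector_mult_add_rdistrib add_ac)

lemma has_derivative_compose_fst:
  assumes "(F has_derivative F') (at (fst z))"
  shows "((\<lambda>y. F (fst y)) has_derivative (\<lambda>u. F' (fst u))) (at z)"
  using diff_chain_at[OF has_derivative_fst[OF has_derivative_ident] assms] by (simp add: o_def)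

lemma has_derivative_toric_metric:
  assumes "fst z \<in> U"
  shows "((\<lambda>y. toric_metric y v w) has_derivative
    (\<lambda>u. fst v \<bullet> (T (fst z) (fst u) *v fst w)
       - (H (fst z) *v snd v) \<bullet> (T (fst z) (fst u) *v (H (fst z) *v snd w)))) (at z)"
proof -
  let ?x = "fst z"
  have 1: "((\<lambda>y. S y *v fst w) has_derivative (\<lambda>u. T ?x u *v fst w)) (at ?x)"
    using bounded_bilinear.FDERIV[OF bounded_bilinear_matrix_vector_mult
        has_derivative_fderiv[OF S_differentiable[OF assms]] has_derivative_const] by simp
  have 2: "((\<lambda>y. H y *v snd w) has_derivative (\<lambda>u. H ?x *v (0 - T ?x u *v (H ?x *v snd w)))) (at ?x)"
    by (intro has_derivative_mult_H_vec assms has_derivative_const)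
  have "((\<lambda>y. toric_metric y v w) has_derivative
    (\<lambda>u. fst v \<bullet> (T ?x (fst u) *v fst w) + snd v \<bullet> (H ?x *v (0 - T ?x (fst u) *v (H ?x *v snd w))))) (at z)"
    unfolding toric_metric_def
    by (intro has_derivative_add has_derivative_inner_right has_derivative_compose_fst 1 2)
  then show ?thesis
    by (simp add: matrix_vector_mult_diff_distrib inner_diff_right
        inner_symmetric_matrix[OF H_sym[OF assms], of "snd v"])
qed

sublocale toric: metric_patch "U \<times> UNIV" toric_metric
proof
  show "open (U \<times> (UNIV :: (real^'n) set))" using open_U by (intro open_Times open_UNIV)
next
  fix z :: "(real^'n) \<times> (real^'n)" assume z: "z \<in> U \<times> UNIV"
  then have x: "fst z \<in> U" by auto
  show "bilinear (toric_metric z)"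
    unfolding bilinear_def toric_metric_def
    by (auto intro!: linearI simp: inner_add_left inner_add_right algebra_simps)
  show "toric_metric z v w = toric_metric z w v" for v w
    unfolding toric_metric_def inner_symmetric_matrix[OF S_sym[OF x]] inner_symmetric_matrix[OF H_sym[OF x]]
    by (metis inner_commute inner_symmetric_matrix[OF S_sym[OF x]] inner_symmetric_matrix[OF H_sym[OF x]])
  show "0 < toric_metric z v v" if "v \<noteq> 0" for v
  proof (cases "fst v = 0")
    case True
    then have "snd v \<noteq> 0" using that by (simp add: prod_eq_iff)
    then show ?thesis using True H_pos[OF x] by (simp add: toric_metric_def)
  next
    case False
    moreover have "snd v \<bullet> (H (fst z) *v snd v) \<ge> 0"
      using H_pos[OF x, of "snd v"] by (cases "snd v = 0") auto
    ultimately show ?thesis using S_pos[OF x, of "fst v"] by (simp add: toric_metric_def)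
  qed
  show "(\<lambda>y. toric_metric y v w) differentiable (at z)" for v w
    using has_derivative_toric_metric[OF x, of v w] unfolding differentiable_def by blast
qed

text \<open>The derivative of \<open>H\<close> along \<open>a\<close> is
  \<open>- (H x ** T x a ** H x)\<close>. Hence angular components enter as \<open>H x *v b\<close>,
  and the second component carries a minus sign. The first component starts with \<open>H x\<close>
  to undo the pairing with \<open>S x\<close>; the second is paired with \<open>H x\<close> and
  needs no such factor.\<close>

definition toric_christoffel :: "real^'n \<Rightarrow> (real^'n) \<times> (real^'n) \<Rightarrow> (real^'n) \<times> (real^'n) \<Rightarrow> (real^'n) \<times> (real^'n)" where
  "toric_christoffel x v w =
     ((1/2) *\<^sub>R (H x *v (T x (fst v) *v fst w + T x (H x *v snd v) *v (H x *v snd w))),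
      - (1/2) *\<^sub>R (T x (fst v) *v (H x *v snd w) + T x (fst w) *v (H x *v snd v)))"

lemma christoffel_toric_metric:
  assumes z: "z \<in> U \<times> UNIV"
  shows "christoffel toric_metric z v w = toric_christoffel (fst z) v w"
proof (rule toric.christoffel_eqI[OF z])
  fix u :: "(real^'n) \<times> (real^'n)"
  have x: "fst z \<in> U" using z by auto
  have D: "fderiv (\<lambda>y. toric_metric y v w) z u = fst v \<bullet> (T (fst z) (fst u) *v fst w)
       - (H (fst z) *v snd v) \<bullet> (T (fst z) (fst u) *v (H (fst z) *v snd w))" for u v w
    by (rule fun_cong[OF fderiv_eqI[OF has_derivative_toric_metric[OF x]]])
  define X where "X = fst z"
  note Tm = inner_symmetric_matrix[OF T_sym[OF x, folded X_def]]
  note Hm = inner_symmetric_matrix[OF H_sym[OF x, folded X_def]]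
  note Sm = inner_symmetric_matrix[OF S_sym[OF x, folded X_def]]
  note cod = codazzi[OF x, folded X_def]
  obtain a b a' b' c d where vw: "v = (a, b)" "w = (a', b')" "u = (c, d)" by (cases v, cases w, cases u)
  \<comment> \<open>The trilinear form \<open>p \<bullet> (T X q *v r)\<close> is totally symmetric,
    being the third derivative of the potential. This collapses the Koszul terms.\<close>
  have k: "p \<bullet> (T X q *v r) = (T X q *v p) \<bullet> r" "p \<bullet> (T X r *v q) = (T X p *v q) \<bullet> r" for p q r
    using Tm cod[of p q] cod[of q r] by metis+
  have "2 * toric_metric z (toric_christoffel X v w) u =
      (T X a *v a' + T X (H X *v b) *v (H X *v b')) \<bullet> c - (T X a *v (H X *v b') + T X a' *v (H X *v b)) \<bullet> (H X *v d)"
    unfolding toric_metric_def toric_christoffel_def X_def[symmetric] vw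
    by (simp add: Sm SH[OF x, folded X_def] matrix_vector_mult_scaleR)
  also have "\<dots> = 2 * koszul toric_metric z v w u"
    unfolding koszul_def D X_def[symmetric] vw
    using k(2)[of a c a'] k(2)[of "H X *v b" c "H X *v b'"] k(1)[of a' a c] k(1)[of a a' c]
      k(1)[of "H X *v b" a' "H X *v d"] k(1)[of "H X *v b'" a "H X *v d"] cod[of a' a]
    by (simp add: inner_add_left)
  finally show "toric_metric z (toric_christoffel (fst z) v w) u = koszul toric_metric z v w u"
    by (simp add: X_def)
qed

text \<open>Equal to \<open>- c \<bullet> S DW(a)\<close> in the notation of the header, hence twice the Ricci tensor on \<open>x\<close>-directions.\<close>

definition ricci_trace :: "real^'n \<Rightarrow> real^'n \<Rightarrow> real^'n \<Rightarrow> real" where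
  "ricci_trace x a c = trace (H x ** Q x a c) - trace (H x ** T x (H x *v (T x a *v c)))
     - trace (H x ** T x a ** H x ** T x c)"

text \<open>The first component is written as a matrix applied to \<open>u\<close>, so that its
  trace can be read off. The second stays an anonymous \<open>R\<close>: the connection is
  independent of the angles, so the trace evaluates \<open>R\<close> only at 0.\<close>

lemma has_derivative_toric_christoffel:
  assumes x: "x \<in> U"
  defines "D \<equiv> \<lambda>p q. H x ** Q x p q - H x ** T x (H x *v (T x p *v q))"
    and "P \<equiv> \<lambda>p q. H x ** T x p ** H x ** T x q"
  shows "\<exists>R. ((\<lambda>y. toric_christoffel y (a, b) (a', b')) has_derivative
    (\<lambda>u. ((1/2) *\<^sub>R ((D a a' + D (H x *v b) (H x *v b') - P (H x *v b) (H x *v b') - P (H x *v b') (H x *v b)) *v u),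
       R u))) (at x)"
proof -
  define \<beta> \<beta>' where "\<beta> = H x *v b" and "\<beta>' = H x *v b'"
  have dH: "((\<lambda>y. H y *v c) has_derivative (\<lambda>u. H x *v (0 - T x u *v (H x *v c)))) (at x)" for c
    by (rule has_derivative_mult_H_vec[OF x has_derivative_const])
  note d1 = has_derivative_add[OF
      has_derivative_T_vec[OF x has_derivative_const[of a] has_derivative_const[of a']]
      has_derivative_T_vec[OF x dH[of b] dH[of b']]]
  note d2 = has_derivative_scaleR_right[OF has_derivative_mult_H_vec[OF x d1], of "1/2"]
  note d3 = has_derivative_scaleR_right[OF has_derivative_add[OF
      has_derivative_T_vec[OF x has_derivative_const[of a] dH[of b']]
      has_derivative_T_vec[OF x has_derivative_const[of a'] dH[of b]]], of "- (1/2)"]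
  have eq: "H x *v (Q x u a *v a' + T x 0 *v a' + T x a *v 0 +
        (Q x u \<beta> *v \<beta>' + T x (H x *v (0 - T x u *v \<beta>)) *v \<beta>' + T x \<beta> *v (H x *v (0 - T x u *v \<beta>'))) -
        T x u *v (H x *v (T x a *v a' + T x \<beta> *v \<beta>')))
      = (D a a' + D \<beta> \<beta>' - P \<beta> \<beta>' - P \<beta>' \<beta>) *v u" for u
  proof -
    \<comment> \<open>Total symmetry moves the direction of differentiation into the last slot,
      where it is the argument of a matrix.\<close>
    have q: "Q x u p *v r = Q x p r *v u" for p r
      using Q_codazzi[OF x, where u = p and a = u and c = r] by (simp only: Q_sym[OF x, where u = u and a = p])
    have t: "T x u *v r = T x r *v u" for r by (rule codazzi[OF x])
    have t': "T x (H x *v - (T x \<beta> *v u)) *v \<beta>' = T x \<beta>' *v (H x *v - (T x \<beta> *v u))"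
      by (rule codazzi[OF x])
    show ?thesis
      unfolding q t D_def P_def diff_0 t' linear_0[OF linear_T[OF x]]
      by (simp add: matrix_vector_mul_assoc[symmetric] matrix_vector_mult_add_rdistrib
          matrix_vector_mult_diff_rdistrib matrix_vector_right_distrib matrix_vector_mult_diff_distrib
          linear_neg[OF matrix_vector_mul_linear] T_simps(1)[OF x])
  qed
  show ?thesis
    unfolding toric_christoffel_def fst_conv snd_conv \<beta>_def[symmetric] \<beta>'_def[symmetric] eq[symmetric]
    by (rule exI, rule has_derivative_Pair[OF d2 d3, folded \<beta>_def \<beta>'_def])
qed

lemma christoffel_toric_differentiable:
  assumes z: "z \<in> U \<times> UNIV"
  shows "(\<lambda>y. christoffel toric_metric y v w) differentiable (at z)"
proof -
  have x: "fst z \<in> U" using z by auto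
  obtain F where "((\<lambda>y. toric_christoffel y v w) has_derivative F) (at (fst z))"
    using has_derivative_toric_christoffel[OF x, of "fst v" "snd v" "fst w" "snd w"]
    unfolding prod.collapse by blast
  from has_derivative_transform_within_open[OF has_derivative_compose_fst[OF this] toric.open_dom z
      christoffel_toric_metric[symmetric]]
  show ?thesis unfolding differentiable_def by blast
qed

lemma sum_Basis_pair:
  "(\<Sum>b\<in>(Basis :: ((real^'n) \<times> (real^'n)) set). F b \<bullet> b) =
    (\<Sum>i\<in>UNIV. fst (F (axis i 1, 0)) $ i) + (\<Sum>i\<in>UNIV. snd (F (0, axis i 1)) $ i)"
proof -
  have "(\<Sum>b\<in>(Basis :: ((real^'n) \<times> (real^'n)) set). F b \<bullet> b) =
      (\<Sum>b\<in>Basis. F (b, 0) \<bullet> (b, 0)) + (\<Sum>b\<in>Basis. F (0, b) \<bullet> (0, b))"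
    unfolding Basis_prod_def
    by (subst sum.union_disjoint) (auto simp: sum.reindex inj_on_def)
  then show ?thesis by (simp add: sum_Basis_vec inner_prod_def inner_axis)
qed

text \<open>The x-block contributes half the trace of \<open>H x ** T x (fst w)\<close>, the angular
  block minus half the trace of the same product in the other order.\<close>

lemma trace_christoffel_toric:
  assumes x: "x \<in> U"
  shows "(\<Sum>b\<in>Basis. toric_christoffel x b w \<bullet> b) = 0"
proof -
  have "fst (toric_christoffel x (e, 0) w) = (1/2) *\<^sub>R ((H x ** T x (fst w)) *v e)"
    "snd (toric_christoffel x (0, e) w) = - (1/2) *\<^sub>R ((T x (fst w) ** H x) *v e)" for e
    by (simp_all add: toric_christoffel_def linear_0[OF linear_T[OF x]] codazzi[OF x, of e]
        matrix_vector_mul_assoc[symmetric])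
  then show ?thesis
    unfolding sum_Basis_pair
    by (simp add: sum_divide_distrib[symmetric] sum_negf sum_matrix_axis trace_mul_sym[of "T x _"])
qed

text \<open>The four terms of \<open>riemann\<close> are traced separately as \<open>s1\<close> to
  \<open>s4\<close>. In \<open>s3\<close> the trace of the connection itself appears, in
  \<open>s2\<close> its derivative, so both vanish.\<close>

lemma ricci_toric_metric:
  assumes z: "z \<in> U \<times> UNIV"
  shows "ricci toric_metric z (a, b) (a', b') =
    (ricci_trace (fst z) a a' + ricci_trace (fst z) (H (fst z) *v b) (H (fst z) *v b')) / 2"
proof -
  define x where "x = fst z"
  have x: "x \<in> U" using z by (auto simp: x_def)
  define \<beta> \<beta>' where "\<beta> = H x *v b" and "\<beta>' = H x *v b'"
  let ?v = "(a, b)" and ?w = "(a', b')"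
  let ?G = "christoffel toric_metric"
  have cz: "?G z v w = toric_christoffel x v w" for v w
    unfolding x_def by (rule christoffel_toric_metric[OF z])
  have zero: "(\<Sum>e\<in>Basis. ?G y e w \<bullet> e) = 0" if "y \<in> U \<times> UNIV" for y w
    using trace_christoffel_toric[of "fst y" w] that by (auto simp: christoffel_toric_metric[OF that])
  have s2: "(\<Sum>e\<in>Basis. fderiv (\<lambda>y. ?G y e ?w) z ?v \<bullet> e) = 0"
  proof -
    have "((\<lambda>y. \<Sum>e\<in>Basis. ?G y e ?w \<bullet> e) has_derivative (\<lambda>u. \<Sum>e\<in>Basis. fderiv (\<lambda>y. ?G y e ?w) z u \<bullet> e)) (at z)"
      by (intro has_derivative_sum has_derivative_inner_left has_derivative_fderiv christoffel_toric_differentiable z)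
    from has_derivative_unique[OF has_derivative_transform_within_open[OF this toric.open_dom z zero] has_derivative_const]
    show ?thesis by meson
  qed
  have s3: "(\<Sum>e\<in>Basis. ?G z e (?G z ?v ?w) \<bullet> e) = 0" by (rule zero[OF z])
  define D where "D = (\<lambda>p q. H x ** Q x p q - H x ** T x (H x *v (T x p *v q)))"
  define P where "P = (\<lambda>p q. H x ** T x p ** H x ** T x q)"
  have s1: "(\<Sum>e\<in>Basis. fderiv (\<lambda>y. ?G y ?v ?w) z e \<bullet> e) = trace (D a a' + D \<beta> \<beta>' - P \<beta> \<beta>' - P \<beta>' \<beta>) / 2"
  proof -
    obtain R where R: "((\<lambda>y. toric_christoffel y ?v ?w) has_derivative
      (\<lambda>u. ((1/2) *\<^sub>R ((D a a' + D \<beta> \<beta>' - P \<beta> \<beta>' - P \<beta>' \<beta>) *v u), R u))) (at x)"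
      using has_derivative_toric_christoffel[OF x, of a b a' b'] unfolding D_def P_def \<beta>_def \<beta>'_def by blast
    from has_derivative_transform_within_open[OF has_derivative_compose_fst[OF R[unfolded x_def]] toric.open_dom z
      christoffel_toric_metric[symmetric]]
    have "fderiv (\<lambda>y. ?G y ?v ?w) z =
      (\<lambda>u. ((1/2) *\<^sub>R ((D a a' + D \<beta> \<beta>' - P \<beta> \<beta>' - P \<beta>' \<beta>) *v fst u), R (fst u)))"
      by (rule fderiv_eqI)
    moreover have "R 0 = 0"
      using linear_0[OF has_derivative_linear[OF R]] by (simp add: zero_prod_def)
    ultimately show ?thesis
      unfolding sum_Basis_pair by (simp add: sum_divide_distrib[symmetric] sum_matrix_axis)
  qed
  have s4: "(\<Sum>e\<in>Basis. ?G z ?v (?G z e ?w) \<bullet> e) = (trace (P a a') - trace (P \<beta> \<beta>')) / 2"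
  proof -
    have c: "toric_christoffel x (a, b) (p, q) =
        ((1/2) *\<^sub>R (H x *v (T x a *v p + T x \<beta> *v (H x *v q))), - (1/2) *\<^sub>R (T x a *v (H x *v q) + T x \<beta> *v p))" for p q
      by (simp add: toric_christoffel_def \<beta>_def codazzi[OF x, of p])
    have c1: "toric_christoffel x (e, 0) (a', b') = ((1/2) *\<^sub>R (H x *v (T x a' *v e)), - (1/2) *\<^sub>R (T x \<beta>' *v e))"
      and c2: "toric_christoffel x (0, e) (a', b') = ((1/2) *\<^sub>R (H x *v (T x \<beta>' *v (H x *v e))), - (1/2) *\<^sub>R (T x a' *v (H x *v e)))" for e
      by (simp_all add: toric_christoffel_def \<beta>'_def codazzi[OF x, of e] codazzi[OF x, of "H x *v e"]
          linear_0[OF linear_T[OF x]])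
    note distrib = P_def matrix_vector_mul_assoc[symmetric] matrix_vector_mult_diff_rdistrib
      matrix_vector_right_distrib matrix_vector_mult_diff_distrib matrix_vector_mult_scaleR
      linear_neg[OF matrix_vector_mul_linear]
    have 1: "fst (?G z ?v (?G z (e, 0) ?w)) = (1/4) *\<^sub>R ((P a a' - P \<beta> \<beta>') *v e)" for e
      unfolding cz c c1 c2 by (simp add: distrib algebra_simps)
    have 2: "snd (?G z ?v (?G z (0, e) ?w)) = (1/4) *\<^sub>R ((T x a ** H x ** T x a' ** H x - T x \<beta> ** H x ** T x \<beta>' ** H x) *v e)" for e
      unfolding cz c c1 c2 by (simp add: distrib algebra_simps)
    \<comment> \<open>Cyclicity equates the traces of the two diagonal blocks, so their factors 1/4
      add up to the 1/2 in \<open>s4\<close>.\<close>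
    have 3: "trace (T x p ** H x ** T x q ** H x) = trace (P p q)" for p q
      using trace_mul_sym[of "T x p ** H x ** T x q" "H x"] by (simp add: P_def matrix_mul_assoc)
    show ?thesis
      unfolding sum_Basis_pair 1 2
      by (simp add: sum_divide_distrib[symmetric] sum_matrix_axis trace_sub 3)
  qed
  \<comment> \<open>\<open>s1\<close> subtracts \<open>P \<beta> \<beta>'\<close> in both orders and
    \<open>s4\<close> gives one copy back. The single copy left makes the angular part equal in form
    to the x-part.\<close>
  have "trace (P p q) = trace (P q p)" for p q
    using trace_mul_sym[of "H x ** T x p" "H x ** T x q"] by (simp add: P_def matrix_mul_assoc)
  then have "ricci toric_metric z ?v ?w = ((trace (D a a') - trace (P a a')) + (trace (D \<beta> \<beta>') - trace (P \<beta> \<beta>'))) / 2"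
    unfolding ricci_def riemann_def inner_diff_left inner_add_left sum_subtractf sum.distrib s1 s2 s3 s4
    by (simp add: trace_add trace_sub field_simps)
  then show ?thesis
    unfolding ricci_trace_def x_def[symmetric] \<beta>_def[symmetric] \<beta>'_def[symmetric]
    by (simp add: D_def P_def trace_sub)
qed

end

section \<open>The Einstein equation in symplectic coordinates\<close>

text \<open>The segment from the identity to \<open>M\<close> consists of positive definite, hence
  invertible, matrices, so the determinant cannot change sign along it.\<close>

lemma det_posdef_pos:
  fixes M :: "real^'n^'n"
  assumes "\<And>v. v \<noteq> 0 \<Longrightarrow> v \<bullet> (M *v v) > 0"
  shows "det M > 0"
proof -
  define A where "A t = (1 - t) *\<^sub>R mat 1 + t *\<^sub>R M" for t :: real
  have nz: "det (A t) \<noteq> 0" if t: "0 \<le> t" "t \<le> 1" for t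
  proof -
    have "v = 0" if "A t *v v = 0" for v
    proof (rule ccontr)
      assume "v \<noteq> 0"
      have "0 = v \<bullet> (A t *v v)" using that by simp
      also have "\<dots> = (1 - t) * (v \<bullet> v) + t * (v \<bullet> (M *v v))"
        by (simp add: A_def matrix_vector_mult_add_rdistrib scaleR_matrix_vector_assoc[symmetric] inner_add_right)
      also have "\<dots> > 0"
        using assms[OF \<open>v \<noteq> 0\<close>] t \<open>v \<noteq> 0\<close>
        by (cases "t = 0") (auto intro!: add_nonneg_pos)
      finally show False by simp
    qed
    then show ?thesis by (simp add: invertible_det_nz[symmetric] invertible_left_inverse matrix_left_invertible_ker)
  qed
  have "continuous_on {0..1} (\<lambda>t. det (A t))"
    unfolding A_def det_def by (intro continuous_intros)
  then have conn: "connected ((\<lambda>t. det (A t)) ` {0..1})"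
    by (rule connected_continuous_image) simp
  have "det (A 0) = 1" "A 1 = M" by (simp_all add: A_def)
  show ?thesis
  proof (rule ccontr)
    assume "\<not> det M > 0"
    then have "0 \<in> (\<lambda>t. det (A t)) ` {0..1}"
      using connectedD_interval[OF conn, of "det (A 1)" "det (A 0)" 0] \<open>det (A 0) = 1\<close> \<open>A 1 = M\<close> by auto
    then show False using nz by auto
  qed
qed

lemma constant_on_connected_open:
  fixes f :: "'a::euclidean_space \<Rightarrow> real"
  assumes "connected U" "open U" and D: "\<And>x. x \<in> U \<Longrightarrow> (f has_derivative (\<lambda>a. 0)) (at x)"
  shows "f constant_on U"
proof (rule has_derivative_zero_connected_constant_on[OF assms(1,2) finite.emptyI])
  show "continuous_on U f"
    using D by (auto intro!: continuous_at_imp_continuous_on has_derivative_continuous)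
  show "\<forall>x\<in>U - {}. (f has_derivative (\<lambda>h. 0)) (at x within U)"
    using D by (auto intro: has_derivative_at_withinI)
qed

context hessian_patch
begin

text \<open>
  The field \<open>W = h \<nabla> log det h\<close>: by Jacobi's formula \<open>log det h\<close> has derivative \<open>- tr (h T\<^sub>a)\<close> along \<open>a\<close>.
\<close>

definition grad_log_det :: "real^'n \<Rightarrow> real^'n" where
  "grad_log_det x = (\<chi> j. - trace (H x ** T x (H x *v axis j 1)))"

lemma linear_trace_H_T:
  assumes x: "x \<in> U"
  shows "linear (\<lambda>a. trace (H x ** T x a))"
  by (rule linearI)
    (simp_all add: T_simps[OF x] bounded_bilinear.add_right[OF bounded_bilinear_matrix_matrix_mult]
      bounded_bilinear.scaleR_right[OF bounded_bilinear_matrix_matrix_mult]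
      linear_add[OF linear_trace] linear_scale[OF linear_trace])

lemma grad_log_det_inner:
  assumes x: "x \<in> U"
  shows "grad_log_det x \<bullet> b = - trace (H x ** T x (H x *v b))"
proof -
  have "linear (\<lambda>b. trace (H x ** T x (H x *v b)))"
    using linear_compose[OF matrix_vector_mul_linear linear_trace_H_T[OF x]] by (simp add: o_def)
  then have "trace (H x ** T x (H x *v b)) = (\<Sum>e\<in>Basis. (b \<bullet> e) * trace (H x ** T x (H x *v e)))"
    by (rule linear_functional_expand)
  moreover have "grad_log_det x \<bullet> b = - (\<Sum>j\<in>UNIV. b $ j * trace (H x ** T x (H x *v axis j 1)))"
    by (simp add: grad_log_det_def inner_vec_def sum_negf mult.commute)
  ultimately show ?thesis by (simp add: sum_Basis_vec inner_axis)
qed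

text \<open>The link between curvature and determinant: in
  \<open>- trace (H y ** T y (H y *v b))\<close> the factor \<open>T\<close> and the two factors
  \<open>H\<close> depend on the point, and differentiating them one at a time yields the three
  terms of \<open>ricci_trace\<close>.\<close>

lemma has_derivative_grad_log_det_inner:
  assumes x: "x \<in> U"
  shows "((\<lambda>y. grad_log_det y \<bullet> b) has_derivative (\<lambda>c. - ricci_trace x c (H x *v b))) (at x)"
proof -
  have 1: "((\<lambda>y. H y *v b) has_derivative (\<lambda>u. H x *v (0 - T x u *v (H x *v b)))) (at x)"
    by (rule has_derivative_mult_H_vec[OF x has_derivative_const])
  have 2: "((\<lambda>y. T y (H y *v b)) has_derivative
      (\<lambda>u. Q x u (H x *v b) + T x (H x *v (0 - T x u *v (H x *v b))))) (at x)"
    by (rule has_derivative_linear_family[OF open_U x linear_T dS_differentiable[OF x] 1])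
  have bt: "bounded_linear (trace :: real^'n^'n \<Rightarrow> real)"
    using linear_trace by (simp add: linear_conv_bounded_linear)
  note mm = bounded_bilinear_matrix_matrix_mult
  have 3: "((\<lambda>y. - trace (H y ** T y (H y *v b))) has_derivative
      (\<lambda>u. - trace (H x ** (Q x u (H x *v b) + T x (H x *v (0 - T x u *v (H x *v b))))
         + (- (H x ** T x u ** H x)) ** T x (H x *v b)))) (at x)"
    by (intro has_derivative_minus bounded_linear.has_derivative[OF bt]
        bounded_bilinear.FDERIV[OF mm] has_derivative_H x 2)
  have "trace (H x ** (Q x u (H x *v b) + T x (H x *v (0 - T x u *v (H x *v b))))
         + (- (H x ** T x u ** H x)) ** T x (H x *v b)) = ricci_trace x u (H x *v b)" for u
    by (simp add: ricci_trace_def bounded_bilinear.add_right[OF mm] bounded_bilinear.minus_left[OF mm]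
        bounded_bilinear.minus_right[OF mm] bounded_bilinear.diff_right[OF mm] trace_sub linear_neg[OF matrix_vector_mul_linear] T_simps[OF x]
        trace_add linear_neg[OF linear_trace])
  with 3 have "((\<lambda>y. - trace (H y ** T y (H y *v b))) has_derivative (\<lambda>c. - ricci_trace x c (H x *v b))) (at x)"
    by simp
  then show ?thesis
    by (rule has_derivative_transform_within_open[OF _ open_U x]) (rule grad_log_det_inner[symmetric])
qed

text \<open>Jacobi's formula gives \<open>- trace (T x a ** H x)\<close>; writing \<open>a\<close>
  as \<open>H x *v (S x *v a)\<close> brings this into the form of
  \<open>grad_log_det_inner\<close>.\<close>

lemma has_derivative_log_det:
  assumes x: "x \<in> U"
  shows "((\<lambda>y. ln (det (H y))) has_derivative (\<lambda>a. grad_log_det x \<bullet> (S x *v a))) (at x)"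
proof -
  have pos: "det (H x) > 0" by (rule det_posdef_pos[OF H_pos[OF x]])
  have "((\<lambda>y. ln (det (H y))) has_derivative
      (\<lambda>a. det (H x) * trace (S x ** - (H x ** T x a ** H x)) * (1 / det (H x)))) (at x)"
    by (rule has_derivative_ln[OF pos has_derivative_det[OF has_derivative_H[OF x] inverse'[OF x]], THEN has_derivative_eq_rhs])
      (simp add: divide_inverse)
  moreover have "det (H x) * trace (S x ** - (H x ** T x a ** H x)) * (1 / det (H x)) = grad_log_det x \<bullet> (S x *v a)" for a
  proof -
    have "trace (S x ** - (H x ** T x a ** H x)) = - trace (T x a ** H x)"
      by (simp add: bounded_bilinear.minus_right[OF bounded_bilinear_matrix_matrix_mult] matrix_mul_assoc
          inverse[OF x] linear_neg[OF linear_trace])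
    then show ?thesis
      using pos by (simp add: grad_log_det_inner[OF x] HS[OF x] trace_mul_sym[of "H x"])
  qed
  ultimately show ?thesis by simp
qed

text \<open>At \<open>H x *v b\<close> and \<open>H x *v b'\<close> the x-part of the metric takes
  the value of its angular part, because \<open>S\<close> and \<open>H\<close> are inverse; the
  equation for the x-part thus implies the other.\<close>

lemma einstein_toric_metric_iff:
  "(\<forall>z\<in>U \<times> UNIV. \<forall>v w. ricci toric_metric z v w = lam * toric_metric z v w) \<longleftrightarrow>
   (\<forall>x\<in>U. \<forall>a c. ricci_trace x a c = 2 * lam * (a \<bullet> (S x *v c)))"
proof (intro iffI ballI allI)
  fix x a c
  assume E: "\<forall>z\<in>U \<times> UNIV. \<forall>v w. ricci toric_metric z v w = lam * toric_metric z v w" and x: "x \<in> U"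
  have r: "(ricci_trace x a c + ricci_trace x (H x *v b) (H x *v d)) / 2 = lam * toric_metric (x, 0) (a, b) (c, d)" for a b c d
    using E x ricci_toric_metric[of "(x, 0)" a b c d] by (metis SigmaI UNIV_I fst_conv)
  show "ricci_trace x a c = 2 * lam * (a \<bullet> (S x *v c))"
    \<comment> \<open>Instantiation follows the order of occurrence \<open>a\<close>,
      \<open>c\<close>, \<open>b\<close>, \<open>d\<close>. The first instance gives
      \<open>ricci_trace x 0 0 = 0\<close>, which is the angular summand of the second.\<close>
    using r[of 0 0 0 0] r[of a c 0 0] by (simp add: toric_metric_def)
next
  fix z v w :: "(real^'n) \<times> (real^'n)"
  assume R: "\<forall>x\<in>U. \<forall>a c. ricci_trace x a c = 2 * lam * (a \<bullet> (S x *v c))"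
    and z: "z \<in> U \<times> (UNIV :: (real^'n) set)"
  obtain a b a' b' where vw: "v = (a, b)" "w = (a', b')" by (cases v, cases w)
  have x: "fst z \<in> U" using z by auto
  show "ricci toric_metric z v w = lam * toric_metric z v w"
    unfolding vw ricci_toric_metric[OF z]
    using R x by (simp add: toric_metric_def SH inner_symmetric_matrix[OF H_sym[OF x]] distrib_left)
qed

text \<open>At \<open>c = H x *v b\<close> the left side says that
  \<open>grad_log_det x \<bullet> b + 2 * lam * (x \<bullet> b)\<close> has derivative zero. The
  vector \<open>C\<close> is assembled from the resulting constants for the coordinate
  vectors.\<close>

lemma ricci_trace_eq_iff_grad_log_det:
  assumes "connected U"
  shows "(\<forall>x\<in>U. \<forall>a c. ricci_trace x a c = 2 * lam * (a \<bullet> (S x *v c))) \<longleftrightarrow>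
    (\<exists>C. \<forall>x\<in>U. grad_log_det x = (- 2 * lam) *\<^sub>R x + C)"
proof
  assume R: "\<forall>x\<in>U. \<forall>a c. ricci_trace x a c = 2 * lam * (a \<bullet> (S x *v c))"
  have "\<exists>C. \<forall>x\<in>U. grad_log_det x \<bullet> b + 2 * lam * (x \<bullet> b) = C" for b
  proof -
    have "((\<lambda>y. grad_log_det y \<bullet> b + 2 * lam * (y \<bullet> b)) has_derivative (\<lambda>c. 0)) (at x)" if x: "x \<in> U" for x
    proof -
      have "((\<lambda>y. grad_log_det y \<bullet> b + 2 * lam * (y \<bullet> b)) has_derivative
          (\<lambda>c. - ricci_trace x c (H x *v b) + 2 * lam * (c \<bullet> b))) (at x)"
        by (intro has_derivative_add has_derivative_grad_log_det_inner x has_derivative_mult_right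
            has_derivative_inner_left has_derivative_ident)
      then show ?thesis using R x by (simp add: SH)
    qed
    then have "(\<lambda>y. grad_log_det y \<bullet> b + 2 * lam * (y \<bullet> b)) constant_on U"
      by (rule constant_on_connected_open[OF assms open_U])
    then show ?thesis unfolding constant_on_def .
  qed
  then obtain k where k: "\<And>b x. x \<in> U \<Longrightarrow> grad_log_det x \<bullet> b + 2 * lam * (x \<bullet> b) = k b" by metis
  have "grad_log_det x = (- 2 * lam) *\<^sub>R x + (\<chi> j. k (axis j 1))" if "x \<in> U" for x
    using k[OF that, of "axis _ 1"] by (simp add: vec_eq_iff inner_axis algebra_simps)
  then show "\<exists>C. \<forall>x\<in>U. grad_log_det x = (- 2 * lam) *\<^sub>R x + C" by blast
next
  assume "\<exists>C. \<forall>x\<in>U. grad_log_det x = (- 2 * lam) *\<^sub>R x + C"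
  then obtain C where C: "\<And>x. x \<in> U \<Longrightarrow> grad_log_det x = (- 2 * lam) *\<^sub>R x + C" by blast
  show "\<forall>x\<in>U. \<forall>a c. ricci_trace x a c = 2 * lam * (a \<bullet> (S x *v c))"
  proof (intro ballI allI)
    fix x a c assume x: "x \<in> U"
    let ?b = "S x *v c"
    have "((\<lambda>y. ((- 2 * lam) *\<^sub>R y + C) \<bullet> ?b) has_derivative (\<lambda>a. ((- 2 * lam) *\<^sub>R a + 0) \<bullet> ?b)) (at x)"
      by (intro has_derivative_inner_left has_derivative_add has_derivative_scaleR_right
          has_derivative_ident has_derivative_const)
    moreover have "((\<lambda>y. ((- 2 * lam) *\<^sub>R y + C) \<bullet> ?b) has_derivative (\<lambda>a. - ricci_trace x a (H x *v ?b))) (at x)"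
      by (rule has_derivative_transform_within_open[OF has_derivative_grad_log_det_inner[OF x] open_U x]) (simp add: C)
    ultimately have "((- 2 * lam) *\<^sub>R a + 0) \<bullet> ?b = - ricci_trace x a (H x *v ?b)"
      by (rule has_derivative_unique[THEN fun_cong])
    then show "ricci_trace x a c = 2 * lam * (a \<bullet> (S x *v c))" by (simp add: HS[OF x])
  qed
qed

text \<open>Differentiating the factor \<open>x\<close> in \<open>x \<bullet> N x\<close> leaves an
  unwanted multiple of \<open>N x \<bullet> a\<close>, and the summand
  \<open>2 * lam * \<Phi> x\<close> is there to cancel it. What remains pairs
  \<open>- 2 * lam * x + C\<close> with \<open>S x *v a\<close>, so the same \<open>C\<close> serves
  on both sides.\<close>

lemma grad_log_det_iff_log_det:
  assumes "connected U"
    and \<Phi>: "\<And>x. x \<in> U \<Longrightarrow> (\<Phi> has_derivative (\<lambda>a. N x \<bullet> a)) (at x)"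
    and N: "\<And>x. x \<in> U \<Longrightarrow> (N has_derivative (\<lambda>a. S x *v a)) (at x)"
  shows "(\<exists>C. \<forall>x\<in>U. grad_log_det x = (- 2 * lam) *\<^sub>R x + C) \<longleftrightarrow>
    (\<exists>C E. \<forall>x\<in>U. ln (det (H x)) = ((- 2 * lam) *\<^sub>R x + C) \<bullet> N x + 2 * lam * \<Phi> x + E)"
proof -
  have D: "((\<lambda>y. ((- 2 * lam) *\<^sub>R y + C) \<bullet> N y + 2 * lam * \<Phi> y + E) has_derivative
      (\<lambda>a. ((- 2 * lam) *\<^sub>R x + C) \<bullet> (S x *v a))) (at x)" if x: "x \<in> U" for x C E
  proof -
    have "((\<lambda>y. ((- 2 * lam) *\<^sub>R y + C) \<bullet> N y + 2 * lam * \<Phi> y + E) has_derivative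
      (\<lambda>a. (((- 2 * lam) *\<^sub>R x + C) \<bullet> (S x *v a) + ((- 2 * lam) *\<^sub>R a + 0) \<bullet> N x) + 2 * lam * (N x \<bullet> a) + 0)) (at x)"
      by (intro has_derivative_add has_derivative_inner has_derivative_mult_right has_derivative_scaleR_right
          has_derivative_ident has_derivative_const \<Phi> N x)
    then show ?thesis by (simp add: inner_commute[of "N x"] add.assoc)
  qed
  show ?thesis
  proof
    assume "\<exists>C. \<forall>x\<in>U. grad_log_det x = (- 2 * lam) *\<^sub>R x + C"
    then obtain C where C: "\<And>x. x \<in> U \<Longrightarrow> grad_log_det x = (- 2 * lam) *\<^sub>R x + C" by blast
    have "((\<lambda>y. ln (det (H y)) - (((- 2 * lam) *\<^sub>R y + C) \<bullet> N y + 2 * lam * \<Phi> y + 0)) has_derivative (\<lambda>a. 0)) (at x)"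
      if x: "x \<in> U" for x
      using has_derivative_diff[OF has_derivative_log_det[OF x] D[OF x, of C 0]] by (simp add: C[OF x])
    then have "(\<lambda>y. ln (det (H y)) - (((- 2 * lam) *\<^sub>R y + C) \<bullet> N y + 2 * lam * \<Phi> y + 0)) constant_on U"
      by (rule constant_on_connected_open[OF assms(1) open_U])
    then obtain E where "\<forall>x\<in>U. ln (det (H x)) - (((- 2 * lam) *\<^sub>R x + C) \<bullet> N x + 2 * lam * \<Phi> x + 0) = E"
      unfolding constant_on_def by blast
    then have "\<forall>x\<in>U. ln (det (H x)) = ((- 2 * lam) *\<^sub>R x + C) \<bullet> N x + 2 * lam * \<Phi> x + E"
      by (auto simp: algebra_simps)
    then show "\<exists>C E. \<forall>x\<in>U. ln (det (H x)) = ((- 2 * lam) *\<^sub>R x + C) \<bullet> N x + 2 * lam * \<Phi> x + E" by blast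
  next
    assume "\<exists>C E. \<forall>x\<in>U. ln (det (H x)) = ((- 2 * lam) *\<^sub>R x + C) \<bullet> N x + 2 * lam * \<Phi> x + E"
    then obtain C E where CE: "\<And>x. x \<in> U \<Longrightarrow> ln (det (H x)) = ((- 2 * lam) *\<^sub>R x + C) \<bullet> N x + 2 * lam * \<Phi> x + E"
      by blast
    have "grad_log_det x = (- 2 * lam) *\<^sub>R x + C" if x: "x \<in> U" for x
    proof -
      have "grad_log_det x \<bullet> (S x *v a) = ((- 2 * lam) *\<^sub>R x + C) \<bullet> (S x *v a)" for a
        by (rule has_derivative_unique[THEN fun_cong, OF has_derivative_log_det[OF x]
              has_derivative_transform_within_open[OF D[OF x] open_U x CE[symmetric]]])
      \<comment> \<open>Vectors of the form \<open>S x *v (H x *v b)\<close> exhaust the space, so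
        equality against all of them is equality.\<close>
      from this[of "H x *v _"] show ?thesis
        unfolding SH[OF x] by (rule vector_eq_rdot[THEN iffD1, OF allI])
    qed
    then show "\<exists>C. \<forall>x\<in>U. grad_log_det x = (- 2 * lam) *\<^sub>R x + C" by blast
  qed
qed

end

section \<open>Kaehler toric manifolds\<close>

lemma matrix_inv_inverse:
  assumes "invertible M"
  shows "M ** matrix_inv M = mat 1" "matrix_inv M ** M = mat 1"
proof -
  have "M ** matrix_inv M = mat 1 \<and> matrix_inv M ** M = mat 1"
    unfolding matrix_inv_def by (rule someI_ex) (use assms in \<open>simp add: invertible_def\<close>)
  then show "M ** matrix_inv M = mat 1" "matrix_inv M ** M = mat 1" by auto
qed

lemma fderiv_expand_partial:
  fixes f :: "real^'n \<Rightarrow> real"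
  assumes "f differentiable (at x)"
  shows "fderiv f x a = (\<Sum>k\<in>UNIV. a $ k * partial k f x)"
  unfolding partial_def
  by (subst linear_functional_expand[OF linear_frechet_derivative[OF assms]]) (simp add: sum_Basis_vec inner_axis)

lemma smooth_on_partial: "smooth_on U f \<Longrightarrow> smooth_on U (partial i f)"
  using smooth_on_fderiv[of U f "axis i 1"] unfolding partial_def[abs_def] .

section \<open>Derivatives of a potential and of its Hessian\<close>

context
  fixes U :: "(real^'n) set" and \<Phi> :: "real^'n \<Rightarrow> real"
  assumes U: "open U" and \<Phi>: "smooth_on U \<Phi>"
begin

lemma partial_partial_commute: "x \<in> U \<Longrightarrow> smooth_on U f \<Longrightarrow> partial i (partial j f) x = partial j (partial i f) x"
  unfolding partial_def
  by (rule fderiv_fderiv_commute[OF U]) (auto intro: smooth_on_differentiable smooth_on_fderiv)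

lemma transpose_hessian: "x \<in> U \<Longrightarrow> transpose (hessian \<Phi> x) = hessian \<Phi> x"
  using partial_partial_commute[OF _ \<Phi>] by (simp add: vec_eq_iff transpose_def hessian_def)

lemma hessian_differentiable:
  assumes x: "x \<in> U"
  shows "hessian \<Phi> differentiable (at x)"
proof (rule differentiable_matrixI)
  show "(\<lambda>y. hessian \<Phi> y $ i $ j) differentiable (at x)" for i j
    using smooth_on_differentiable[OF smooth_on_partial[OF smooth_on_partial[OF \<Phi>]] x, of i j]
    by (simp add: hessian_def)
qed

lemma fderiv_hessian:
  assumes x: "x \<in> U"
  shows "fderiv (hessian \<Phi>) x a $ i $ j = fderiv (partial i (partial j \<Phi>)) x a"
proof -
  have "(\<lambda>y. hessian \<Phi> y $ i $ j) = partial i (partial j \<Phi>)"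
    by (simp add: hessian_def)
  moreover have "((\<lambda>y. hessian \<Phi> y $ i $ j) has_derivative (\<lambda>a. fderiv (hessian \<Phi>) x a $ i $ j)) (at x)"
    by (intro bounded_linear.has_derivative[OF bounded_linear_vec_nth]
        has_derivative_fderiv hessian_differentiable x)
  ultimately have "(partial i (partial j \<Phi>) has_derivative (\<lambda>a. fderiv (hessian \<Phi>) x a $ i $ j)) (at x)"
    by simp
  from fun_cong[OF fderiv_eqI[OF this], of a] show ?thesis by simp
qed

lemma fderiv_hessian_differentiable:
  assumes x: "x \<in> U"
  shows "(\<lambda>y. fderiv (hessian \<Phi>) y a) differentiable (at x)"
proof (rule differentiable_matrixI)
  fix i j
  have "(\<lambda>y. fderiv (partial i (partial j \<Phi>)) y a) differentiable (at x)"
    by (intro smooth_on_differentiable[OF _ x] smooth_on_fderiv smooth_on_partial \<Phi>)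
  then show "(\<lambda>y. fderiv (hessian \<Phi>) y a $ i $ j) differentiable (at x)"
    by (rule differentiable_cong_open[OF U x, THEN iffD1, rotated]) (simp add: fderiv_hessian)
qed

lemma fderiv_hessian_codazzi:
  assumes x: "x \<in> U"
  shows "fderiv (hessian \<Phi>) x a *v c = fderiv (hessian \<Phi>) x c *v a"
proof -
  \<comment> \<open>The indices to be exchanged, \<open>j\<close> and \<open>k\<close>, are placed
    outermost, so that their exchange is symmetry of second derivatives for
    \<open>partial i \<Phi>\<close>.\<close>
  define d where "d i j k = partial k (partial j (partial i \<Phi>)) x" for i j k
  have d_sym: "d i j k = d i k j" for i j k
    unfolding d_def by (rule partial_partial_commute[OF x smooth_on_partial[OF \<Phi>]])
  have "fderiv (hessian \<Phi>) x a $ i $ j = (\<Sum>k\<in>UNIV. a $ k * d i j k)" for a i j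
  proof -
    have "fderiv (hessian \<Phi>) x a $ i $ j = fderiv (partial j (partial i \<Phi>)) x a"
      unfolding fderiv_hessian[OF x]
      by (subst fderiv_cong_open[OF U x, of "partial i (partial j \<Phi>)" "partial j (partial i \<Phi>)"])
        (simp_all add: partial_partial_commute[OF _ \<Phi>])
    also have "\<dots> = (\<Sum>k\<in>UNIV. a $ k * d i j k)"
      unfolding d_def
      by (intro fderiv_expand_partial smooth_on_differentiable[OF _ x] smooth_on_partial \<Phi>)
    finally show ?thesis .
  qed
  then have e: "(fderiv (hessian \<Phi>) x a *v c) $ i = (\<Sum>j\<in>UNIV. \<Sum>k\<in>UNIV. a $ k * c $ j * d i j k)" for a c i
    by (simp add: matrix_vector_mult_def sum_distrib_left mult_ac)
  have "(fderiv (hessian \<Phi>) x a *v c) $ i = (fderiv (hessian \<Phi>) x c *v a) $ i" for i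
    unfolding e by (subst sum.swap) (simp add: d_sym[of i] mult_ac)
  then show ?thesis by (simp add: vec_eq_iff)
qed

lemma has_derivative_gradient:
  assumes x: "x \<in> U"
  shows "((\<lambda>y. \<chi> j. partial j \<Phi> y) has_derivative (\<lambda>a. hessian \<Phi> x *v a)) (at x)"
  unfolding has_derivative_componentwise_within[of "\<lambda>y. \<chi> j. partial j \<Phi> y"]
proof
  fix b :: "real^'n" assume "b \<in> Basis"
  then obtain j where b: "b = axis j 1" unfolding Basis_vec_def by auto
  have d: "partial j \<Phi> differentiable (at x)"
    by (intro smooth_on_differentiable[OF _ x] smooth_on_partial \<Phi>)
  have "(hessian \<Phi> x *v a) $ j = fderiv (partial j \<Phi>) x a" for a
    unfolding fderiv_expand_partial[OF d]
    by (simp add: matrix_vector_mult_def hessian_def partial_partial_commute[OF x \<Phi>, of j] mult.commute)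
  then show "((\<lambda>y. (\<chi> j. partial j \<Phi> y) \<bullet> b) has_derivative (\<lambda>a. (hessian \<Phi> x *v a) \<bullet> b)) (at x)"
    using has_derivative_fderiv[OF d] by (simp add: b inner_axis)
qed

lemma has_derivative_inner_gradient:
  assumes x: "x \<in> U"
  shows "(\<Phi> has_derivative (\<lambda>a. (\<chi> j. partial j \<Phi> x) \<bullet> a)) (at x)"
proof -
  have d: "\<Phi> differentiable (at x)" by (rule smooth_on_differentiable[OF \<Phi> x])
  have "fderiv \<Phi> x = (\<lambda>a. (\<chi> j. partial j \<Phi> x) \<bullet> a)"
    unfolding fderiv_expand_partial[OF d] by (simp add: inner_vec_def mult.commute)
  with has_derivative_fderiv[OF d] show ?thesis by simp
qed

end

text \<open>Positivity is given for \<open>h\<close> and passes to its inverse by the substitution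
  \<open>v = h x *v w\<close>.\<close>

lemma hessian_patch_symplectic_potential:
  assumes U: "open U" and pot: "symplectic_potential U h \<Phi>"
    and pos: "\<And>x v. x \<in> U \<Longrightarrow> v \<noteq> 0 \<Longrightarrow> v \<bullet> (h x *v v) > 0"
  shows "hessian_patch U (hessian \<Phi>) h"
proof -
  have \<Phi>: "smooth_on U \<Phi>" and S: "\<And>x. x \<in> U \<Longrightarrow> matrix_inv (h x) = hessian \<Phi> x"
    using pot by (simp_all add: symplectic_potential_def)
  have inv: "hessian \<Phi> x ** h x = mat 1" "h x ** hessian \<Phi> x = mat 1" if x: "x \<in> U" for x
  proof -
    have "invertible (h x)"
      using det_posdef_pos[OF pos[OF x]] by (simp add: invertible_det_nz)
    then show "hessian \<Phi> x ** h x = mat 1" "h x ** hessian \<Phi> x = mat 1"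
      using matrix_inv_inverse S[OF x] by metis+
  qed
  show ?thesis
  proof
    show "v \<bullet> (hessian \<Phi> x *v v) > 0" if x: "x \<in> U" and "v \<noteq> 0" for x v
    proof -
      let ?w = "hessian \<Phi> x *v v"
      have "h x *v ?w = v" by (simp add: matrix_vector_mul_assoc inv[OF x])
      moreover then have "?w \<noteq> 0" using \<open>v \<noteq> 0\<close> by auto
      ultimately show ?thesis using pos[OF x, of ?w] by (simp add: inner_commute)
    qed
  qed (use U transpose_hessian[OF U \<Phi>] hessian_differentiable[OF U \<Phi>] fderiv_hessian_differentiable[OF U \<Phi>]
        fderiv_hessian_codazzi[OF U \<Phi>] inv in auto)
qed

lemma metric_patch_chart:
  assumes "complex_atlas A" "riemannian_metric A g" "c \<in> A"
  shows "metric_patch (cimg c) (g c)"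
proof
  show "open (cimg c)" using assms by (simp add: complex_atlas_def)
qed (use assms in \<open>auto simp: riemannian_metric_def intro: smooth_on_differentiable\<close>)

text \<open>Where \<open>k\<close> is nonzero it is so on an open set, which would meet
  \<open>F\<close>. The domain \<open>D\<close> will be that of a chart, since the Einstein defect
  is a function on one chart at a time.\<close>

lemma dense_open_zero:
  fixes k :: "'a::topological_space \<Rightarrow> real"
  assumes "open D" "continuous_on D k" "closure F = UNIV" "\<And>m. m \<in> D \<inter> F \<Longrightarrow> k m = 0" "m \<in> D"
  shows "k m = 0"
proof (rule ccontr)
  assume "k m \<noteq> 0"
  define O' where "O' = D \<inter> k -` (- {0})"
  have "open O'" unfolding O'_def using assms(1,2) by (intro continuous_open_preimage) auto
  moreover have "O' \<inter> closure F \<noteq> {}" using \<open>k m \<noteq> 0\<close> assms by (auto simp: O'_def)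
  ultimately have "O' \<inter> F \<noteq> {}" by (simp add: open_Int_closure_eq_empty)
  then show False using assms(4) by (auto simp: O'_def)
qed

section \<open>Passage between the manifold and the moment region\<close>

locale toric_data =
  fixes A :: "('m::{t2_space,second_countable_topology}, 'n::finite) chart set"
    and g :: "('m, 'n) form" and \<alpha> :: "real^'n \<Rightarrow> 'm \<Rightarrow> 'm" and \<mu> :: "'m \<Rightarrow> real^'n"
    and P :: "(real^'n) \<times> (real^'n) \<Rightarrow> 'm" and h :: "real^'n \<Rightarrow> real^'n^'n" and \<Phi> :: "real^'n \<Rightarrow> real"
  assumes toric: "kaehler_toric A g \<alpha> \<mu>"
    and coords: "symplectic_coordinates A g \<alpha> \<mu> P h"
    and potential: "symplectic_potential (moment_region \<alpha> \<mu>) h \<Phi>"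
begin

abbreviation "U \<equiv> moment_region \<alpha> \<mu>"

lemma atlas: "complex_atlas A" and metric: "riemannian_metric A g"
  using toric by (simp_all add: kaehler_toric_def kaehler_metric_def)

lemma open_U: "open U" and smooth_P: "smooth_into A (U \<times> UNIV) P" and image_P: "P ` (U \<times> UNIV) = free_locus \<alpha>"
  and h_pos: "x \<in> U \<Longrightarrow> v \<noteq> 0 \<Longrightarrow> v \<bullet> (h x *v v) > 0"
  using coords by (simp_all add: symplectic_coordinates_def)

lemma smooth_potential: "smooth_on U \<Phi>"
  using potential by (simp add: symplectic_potential_def)

sublocale hessian_patch U "hessian \<Phi>" h
  by (rule hessian_patch_symplectic_potential[OF open_U potential h_pos])

text \<open>This makes the integration constants \<open>C\<close> and \<open>E\<close> global. The
  region is the image of the connected free locus under \<mu>, whose continuity is checked chart by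
  chart.\<close>

lemma connected_U: "connected U"
proof -
  have "continuous_on (cdom c) \<mu>" if c: "c \<in> A" for c
  proof -
    have hom: "homeomorphism (cdom c) (cimg c) (cmap c) (cinv c)"
      using atlas c by (simp add: complex_atlas_def)
    have "smooth_on (cimg c) (\<mu> \<circ> cinv c)"
      using toric c by (simp add: kaehler_toric_def moment_map_def smooth_fun_def)
    then have "continuous_on (cimg c) (\<mu> \<circ> cinv c)" by (rule smooth_on_continuous_on)
    then have "continuous_on (cdom c) ((\<mu> \<circ> cinv c) \<circ> cmap c)"
      using hom by (intro continuous_on_compose[of _ "cmap c"]) (simp_all only: homeomorphism_def)
    then show ?thesis
      by (rule continuous_on_eq) (use hom in \<open>simp add: homeomorphism_def\<close>)
  qed
  then have "continuous_on (\<Union>c\<in>A. cdom c) \<mu>"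
    using atlas by (intro continuous_on_open_UN) (auto simp: complex_atlas_def)
  then have "continuous_on (free_locus \<alpha>) \<mu>"
    by (rule continuous_on_subset) (use atlas in \<open>simp add: complex_atlas_def\<close>)
  then show ?thesis
    unfolding moment_region_def using toric
    by (intro connected_continuous_image) (simp_all add: kaehler_toric_def)
qed

lemma metric_pullback_chart:
  assumes d: "d \<in> A"
  shows "metric_pullback ((U \<times> UNIV) \<inter> P -` cdom d) toric_metric (cimg d) (g d) (cmap d \<circ> P)"
proof -
  let ?W = "(U \<times> UNIV) \<inter> P -` cdom d"
  have oW: "open ?W"
    using smooth_P atlas d open_U unfolding smooth_into_def complex_atlas_def
    by (intro continuous_open_preimage) (auto intro: open_Times)
  interpret d: metric_patch "cimg d" "g d" by (rule metric_patch_chart[OF atlas metric d])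
  show ?thesis
  proof
    fix z v w :: "(real^'n) \<times> (real^'n)" assume z: "z \<in> ?W"
    obtain x \<phi> where x: "z = (x, \<phi>)" "x \<in> U" using z by auto
    obtain a b a' b' where vw: "v = (a, b)" "w = (a', b')" by (cases v, cases w)
    have "toric_metric z v w = (\<Sum>i\<in>UNIV. \<Sum>j\<in>UNIV. matrix_inv (h x) $ i $ j * a $ i * a' $ j)
          + (\<Sum>i\<in>UNIV. \<Sum>j\<in>UNIV. h x $ i $ j * b $ i * b' $ j)"
      using potential x(2)
      by (simp add: toric_metric_def x vw symplectic_potential_def inner_vec_def matrix_vector_mult_def
          sum_distrib_left mult_ac)
    also have "\<dots> = pullback_form g d P z v w"
      using coords d z unfolding symplectic_coordinates_def x vw by auto
    finally show "toric_metric z v w = g d ((cmap d \<circ> P) z) (fderiv (cmap d \<circ> P) z v) (fderiv (cmap d \<circ> P) z w)"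
      by (simp add: pullback_form_def)
  next
    show "smooth_on ?W (cmap d \<circ> P)" using smooth_P d by (simp add: smooth_into_def)
    show "DIM((real^'n) \<times> (real^'n)) = DIM(complex^'n)" by simp
  qed (use oW toric.bilinear_metric toric.metric_sym toric.metric_pos toric.metric_differentiable in auto)
qed

lemma Ck_on_christoffel_chart:
  assumes d: "d \<in> A"
  shows "Ck_on k (cimg d) (\<lambda>z. christoffel (g d) z v w)"
proof -
  interpret d: metric_patch "cimg d" "g d" by (rule metric_patch_chart[OF atlas metric d])
  show ?thesis
    using metric d by (intro d.Ck_on_christoffel) (auto simp: riemannian_metric_def smooth_on_def simp del: Ck_on.simps)
qed

lemma ricci_chart:
  assumes d: "d \<in> A" and z: "z \<in> U \<times> UNIV" and Pz: "P z \<in> cdom d"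
  shows "ricci (g d) (cmap d (P z)) (fderiv (cmap d \<circ> P) z v) (fderiv (cmap d \<circ> P) z w) = ricci toric_metric z v w"
    and "g d (cmap d (P z)) (fderiv (cmap d \<circ> P) z v) (fderiv (cmap d \<circ> P) z w) = toric_metric z v w"
    and "surj (fderiv (cmap d \<circ> P) z)"
proof -
  interpret metric_pullback "(U \<times> UNIV) \<inter> P -` cdom d" toric_metric "cimg d" "g d" "cmap d \<circ> P"
    by (rule metric_pullback_chart[OF d])
  have z': "z \<in> (U \<times> UNIV) \<inter> P -` cdom d" using z Pz by simp
  have "ricci (g d) ((cmap d \<circ> P) z) (df z v) (df z w) = ricci toric_metric z v w"
  proof (rule ricci_pullback[OF _ _ z'])
    show "(\<lambda>y. christoffel toric_metric y v w) differentiable (at x)"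
      if "x \<in> (U \<times> UNIV) \<inter> P -` cdom d" for x v w
      using that by (intro christoffel_toric_differentiable) simp
    show "(\<lambda>y. christoffel (g d) y v w) differentiable (at x)" if "x \<in> cimg d" for x v w
      using Ck_on_christoffel_chart[OF d, of "Suc 0" v w] that unfolding Ck_on.simps by blast
  qed
  then show "ricci (g d) (cmap d (P z)) (df z v) (df z w) = ricci toric_metric z v w" by simp
  show "g d (cmap d (P z)) (df z v) (df z w) = toric_metric z v w"
    using pullback[OF z'] by simp
  show "surj (df z)" by (rule surj_df[OF z'])
qed

lemma einstein_iff_toric:
  "einstein A g lam \<longleftrightarrow> (\<forall>z\<in>U \<times> UNIV. \<forall>v w. ricci toric_metric z v w = lam * toric_metric z v w)"
proof (intro iffI ballI allI)
  fix z v w assume E: "einstein A g lam" and z: "z \<in> U \<times> (UNIV :: (real^'n) set)"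
  obtain d where d: "d \<in> A" "P z \<in> cdom d" using atlas unfolding complex_atlas_def by blast
  show "ricci toric_metric z v w = lam * toric_metric z v w"
    using E d ricci_chart(1,2)[OF d(1) z d(2), of v w] unfolding einstein_def by (metis image_eqI)
next
  assume R: "\<forall>z\<in>U \<times> UNIV. \<forall>v w. ricci toric_metric z v w = lam * toric_metric z v w"
  show "einstein A g lam"
    unfolding einstein_def
  proof (intro ballI allI)
    fix c y v w assume c: "c \<in> A" and y: "y \<in> cimg c"
    interpret c: metric_patch "cimg c" "g c" by (rule metric_patch_chart[OF atlas metric c])
    have hom: "homeomorphism (cdom c) (cimg c) (cmap c) (cinv c)" and oc: "open (cdom c)"
      using atlas c by (simp_all add: complex_atlas_def)
    let ?k = "\<lambda>y. ricci (g c) y v w - lam * g c y v w"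
    have "continuous_on (cimg c) ?k"
      using metric c by (intro continuous_intros c.continuous_on_ricci Ck_on_christoffel_chart)
        (auto simp: riemannian_metric_def intro: smooth_on_continuous_on)
    then have ck: "continuous_on (cdom c) (?k \<circ> cmap c)"
      using hom by (intro continuous_on_compose) (simp_all only: homeomorphism_def)
    obtain m where m: "m \<in> cdom c" "y = cmap c m" using y by auto
    have "(?k \<circ> cmap c) m = 0"
    proof (rule dense_open_zero[OF oc ck _ _ m(1)])
      show "closure (free_locus \<alpha>) = UNIV" using toric by (simp add: kaehler_toric_def)
      fix m assume m: "m \<in> cdom c \<inter> free_locus \<alpha>"
      then obtain z where z: "z \<in> U \<times> UNIV" "m = P z" using image_P by blast
      have Pz: "P z \<in> cdom c" using m z by simp
      \<comment> \<open>Arbitrary tangent vectors of the complex chart are lifted to symplectic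
        coordinates by surjectivity of the differential.\<close>
      obtain v' w' where "v = fderiv (cmap c \<circ> P) z v'" "w = fderiv (cmap c \<circ> P) z w'"
        using ricci_chart(3)[OF c z(1) Pz] by (metis surjD)
      moreover have "ricci toric_metric z v' w' = lam * toric_metric z v' w'" using R z(1) by blast
      ultimately show "(?k \<circ> cmap c) m = 0"
        using ricci_chart(1,2)[OF c z(1) Pz, of v' w'] by (simp add: z(2))
    qed
    then show "ricci (g c) y v w = lam * g c y v w" by (simp add: m)
  qed
qed

end

theorem theorem6p1:
  fixes A :: "('m::{t2_space,second_countable_topology}, 'n::finite) chart set"
    and g :: "('m, 'n) form"
    and \<alpha> :: "real^'n \<Rightarrow> 'm \<Rightarrow> 'm"
    and \<mu> :: "'m \<Rightarrow> real^'n"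
    and P :: "(real^'n) \<times> (real^'n) \<Rightarrow> 'm"
    and h :: "real^'n \<Rightarrow> real^'n^'n"
    and \<Phi> :: "real^'n \<Rightarrow> real"
    and lam :: real
  assumes "kaehler_toric A g \<alpha> \<mu>"
    and "symplectic_coordinates A g \<alpha> \<mu> P h"
    and "symplectic_potential (moment_region \<alpha> \<mu>) h \<Phi>"
  shows "einstein A g lam \<longleftrightarrow>
    (\<exists>(C :: real^'n) (E :: real). \<forall>x\<in>moment_region \<alpha> \<mu>.
       ln (det (h x)) =
         (\<Sum>j\<in>UNIV. (- 2 * lam * x $ j + C $ j) * partial j \<Phi> x) + 2 * lam * \<Phi> x + E)"
proof -
  interpret toric_data A g \<alpha> \<mu> P h \<Phi>
    using assms by unfold_locales
  have "((- 2 * lam) *\<^sub>R x + C) \<bullet> (\<chi> j. partial j \<Phi> x) = (\<Sum>j\<in>UNIV. (- 2 * lam * x $ j + C $ j) * partial j \<Phi> x)"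
    for x C :: "real^'n"
    by (simp add: inner_vec_def)
  note grad_log_det_iff_log_det[OF connected_U has_derivative_inner_gradient[OF open_U smooth_potential]
      has_derivative_gradient[OF open_U smooth_potential], of lam, unfolded this]
  then show ?thesis
    unfolding einstein_iff_toric einstein_toric_metric_iff ricci_trace_eq_iff_grad_log_det[OF connected_U] .
qed

end
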